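(* Let $p \geq 2$ be an integer. Then the convergence $$\lim_{n \rightarrow \infty} \mathbb{E}T_n^p = (\mathbb{E}X^2/\mathbb{E}X)^p$$ is equivalent to the tail condition $$\mathbb{P}\{X \geq x\} = o(x^{-p-1}) \text{ as } x \rightarrow \infty.$$ Moreover, if $\mathbb{P}\{X \geq x\} = O(x^{-p-3/2})$ as $x \rightarrow \infty$, then $$\mathbb{E}T_n^p - (\mathbb{E}X^2/\mathbb{E}X)^p = O(n^{-1/2}).$$ The finiteness of the moment $\mathbb{E}X^{p+1}$ is sufficient for the convergence $\lim_{n \rightarrow \infty} \mathbb{E}T_n^p = (\mathbb{E}X^2/\mathbb{E}X)^p$ to hold, while the finiteness of the moments $\mathbb{E}X^q$ is necessary for this convergence for any real value $1 \leq q < p + 1$.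
   Context: Let $X, X_1, \dots, X_n$ be i.i.d. positive random variables with a finite second moment, and define the statistic $$T_n = \frac{X_1^2 + \dots + X_n^2}{X_1 + \dots + X_n}.$$ By the law of large numbers, with probability one $\lim_{n \rightarrow \infty} T_n^p = (\mathbb{E}X^2/\mathbb{E}X)^p$ for any $p \geq 1$; the theorem describes when this convergence also holds on average. *)

theory Defs
  imports "HOL-Probability.Probability"
begin

text \<open>The statistic T_n = (X_1^2 + ... + X_n^2)/(X_1 + ... + X_n), where the sample
  X_1,...,X_n is represented by the first n members X 0, ..., X (n-1) of an i.i.d. sequence.\<close>
definition T_stat :: "(nat \<Rightarrow> 'a \<Rightarrow> real) \<Rightarrow> nat \<Rightarrow> 'a \<Rightarrow> real" where
  "T_stat X n \<omega> = (\<Sum>i<n. (X i \<omega>)^2) / (\<Sum>i<n. X i \<omega>)"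

end

(* Write S = X_1 + ... + X_n and Q = X_1^2 + ... + X_n^2, so that T_n = Q/S, and put a = E X,
   b = E X^2. By exchangeability, E[Q g(Q,S)] = n E[x^2 g(Q' + x^2, S' + x)], where x = X_n and
   Q', S' are built from the first n - 1 variables. Iterating this identity p times in
   E[Q^p / S^p] extracts the main term (n b)^p E[S^(-p)], approximately (b/a)^p.

   Upper bound: S is replaced by max(S, n a / 2), at the price of an exponentially small error,
   and the other terms of the binomial expansion of (Q' + x^2)^(q-1) are at most a constant times
   n E[(X^2 / max(X, n a / 2))^j], 2 <= j <= p. By the layer cake formula these are o(1) if
   P(X >= x) = o(x^(-p-1)), and O(n^(-1/2)) if P(X >= x) = O(x^(-p-3/2)).

   Lower bound: with x truncated at sqrt n and Jensen's inequality for s^(-p) the iteration gives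
   at least (b/a)^p - o(1). If in addition the contribution x^(2p) / (S' + x)^p of one large summand
   is kept, it is at least a constant times n^(p+1) P(X >= n), and therefore tends to 0 whenever
   E T_n^p tends to (b/a)^p. *)
theory Submission
  imports Defs
begin

text \<open>Two obstacles shape the development. E[S^(-p)] may be infinite, since the variables may
  concentrate near 0, and E T_n^p itself may be infinite; the moments are therefore integrals in
  \<open>ennreal\<close>, where exchangeability and Fubini hold without integrability. The floor
  \<open>\<theta> = n a / 2\<close> tames the negative moments from above. It is half the mean of S,
  so S rarely falls below it, and when it does T_n is still at most the largest summand. Dividing by
  \<open>\<theta>\<close> makes all quotients bounded uniformly in n, with S /
  \<open>\<theta>\<close> near 2. The exponents in the theorem come from one count: under a tail of
  order x^(-\<alpha>), jumps of size about n contribute n * n^(j - \<alpha>) to the j-th remainder,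
  which is worst for j = p. This is bounded for \<alpha> = p + 1 and of order n^(-1/2), the size of
  the fluctuations of S / n, for \<alpha> = p + 3/2. The level sqrt n tends to infinity, so
  E[X^2; X <= sqrt n] tends to b, while p summands of that size change S only by a relative error
  n^(-1/2).\<close>

locale iid_positive = prob_space M for M :: "'a measure" +
  fixes X :: "nat \<Rightarrow> 'a \<Rightarrow> real"
  assumes rv [measurable]: "\<And>i. X i \<in> borel_measurable M"
    and indep: "indep_vars (\<lambda>_. borel) X UNIV"
    and ident: "\<And>i. distr M borel (X i) = distr M borel (X 0)"
    and pos: "\<And>i \<omega>. \<omega> \<in> space M \<Longrightarrow> X i \<omega> > 0"
    and sq: "integrable M (\<lambda>\<omega>. (X 0 \<omega>)^2)"
begin

definition Q :: "nat \<Rightarrow> 'a \<Rightarrow> real" where "Q n \<omega> = (\<Sum>i<n. (X i \<omega>)\<^sup>2)"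
definition S :: "nat \<Rightarrow> 'a \<Rightarrow> real" where "S n \<omega> = (\<Sum>i<n. X i \<omega>)"
definition a :: real where "a = expectation (X 0)"
definition b :: real where "b = expectation (\<lambda>\<omega>. (X 0 \<omega>)\<^sup>2)"

lemma Q_measurable [measurable]: "Q n \<in> borel_measurable M"
  unfolding Q_def by measurable

lemma S_measurable [measurable]: "S n \<in> borel_measurable M"
  unfolding S_def by measurable

section \<open>Singling out one summand by exchangeability\<close>

text \<open>\<open>X n\<close> is independent of the earlier variables and distributed as
  \<open>X 0\<close>, so the last summand can be read at a point \<open>\<omega>0\<close> of a
  second copy of \<open>M\<close>. \<open>V\<close> may be vector-valued, which lets one application
  follow several sums at once.\<close>

lemma nn_integral_walk_Suc:
  fixes V :: "real \<Rightarrow> 'b :: {second_countable_topology, real_normed_vector}"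
  assumes [measurable]: "V \<in> borel_measurable borel" "f \<in> borel_measurable borel"
  shows "(\<integral>\<^sup>+\<omega>. f (\<Sum>i<Suc n. V (X i \<omega>)) \<partial>M) =
    (\<integral>\<^sup>+\<omega>0. \<integral>\<^sup>+\<omega>. f ((\<Sum>i<n. V (X i \<omega>)) + V (X 0 \<omega>0)) \<partial>M \<partial>M)"
proof -
  let ?Z = "\<lambda>\<omega>. \<Sum>i<n. V (X i \<omega>)"
  have "indep_var borel ((\<lambda>f. V (f n)) \<circ> (\<lambda>\<omega>. restrict (\<lambda>i. X i \<omega>) {n}))
    borel ((\<lambda>f. \<Sum>i<n. V (f i)) \<circ> (\<lambda>\<omega>. restrict (\<lambda>i. X i \<omega>) {..<n}))"
    by (intro indep_var_compose[OF indep_var_restrict[OF indep]]) auto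
  then have ind: "indep_var borel (\<lambda>\<omega>. V (X n \<omega>)) borel ?Z"
    by (auto simp: o_def cong: sum.cong_simp)
  interpret Y: prob_space "distr M borel (\<lambda>\<omega>. V (X n \<omega>))" by (rule prob_space_distr) simp
  interpret Z: prob_space "distr M borel ?Z" by (rule prob_space_distr) simp
  have m [measurable]: "(\<lambda>z. f (snd z + fst z)) \<in> borel_measurable (borel \<Otimes>\<^sub>M borel)"
    by measurable
  have "(\<integral>\<^sup>+\<omega>. f (\<Sum>i<Suc n. V (X i \<omega>)) \<partial>M) =
    (\<integral>\<^sup>+z. f (snd z + fst z) \<partial>distr M (borel \<Otimes>\<^sub>M borel) (\<lambda>\<omega>. (V (X n \<omega>), ?Z \<omega>)))"
    by (subst nn_integral_distr) (use m in \<open>simp_all add: add.commute\<close>)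
  also have "\<dots> = (\<integral>\<^sup>+z. f (snd z + fst z) \<partial>(distr M borel (\<lambda>\<omega>. V (X n \<omega>)) \<Otimes>\<^sub>M distr M borel ?Z))"
    using ind by (simp add: indep_var_distribution_eq)
  also have "\<dots> = (\<integral>\<^sup>+y. \<integral>\<^sup>+z. f (z + y) \<partial>distr M borel ?Z \<partial>distr M borel (\<lambda>\<omega>. V (X n \<omega>)))"
    by (subst Z.nn_integral_fst[symmetric]) simp_all
  also have "distr M borel (\<lambda>\<omega>. V (X n \<omega>)) = distr (distr M borel (X n)) borel V"
    by (simp add: distr_distr o_def)
  also have "\<dots> = distr M borel (\<lambda>\<omega>. V (X 0 \<omega>))"
    by (subst ident) (simp add: distr_distr o_def)
  also have "(\<integral>\<^sup>+y. \<integral>\<^sup>+z. f (z + y) \<partial>distr M borel ?Z \<partial>distr M borel (\<lambda>\<omega>. V (X 0 \<omega>))) =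
    (\<integral>\<^sup>+\<omega>0. \<integral>\<^sup>+z. f (z + V (X 0 \<omega>0)) \<partial>distr M borel ?Z \<partial>M)"
    by (subst nn_integral_distr) (auto)
  also have "\<dots> = (\<integral>\<^sup>+\<omega>0. \<integral>\<^sup>+\<omega>. f (?Z \<omega> + V (X 0 \<omega>0)) \<partial>M \<partial>M)"
    by (intro nn_integral_cong) (subst nn_integral_distr, auto)
  finally show ?thesis .
qed

text \<open>Exchangeability without permutations: in the induction the last variable is moved to a
  separate point \<open>\<omega>0\<close>. Its own weight gives one copy of the right-hand side; the
  induction hypothesis for the other weights gives \<open>Suc n\<close> copies with two separate
  points, whose roles Fubini interchanges.\<close>

lemma nn_integral_pick_summand:
  fixes V :: "real \<Rightarrow> 'b :: {second_countable_topology, real_normed_vector}"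
    and h :: "real \<Rightarrow> real"
  assumes [measurable]: "V \<in> borel_measurable borel" "h \<in> borel_measurable borel"
    "f \<in> borel_measurable borel"
    and h: "\<And>x. h x \<ge> 0"
  shows "(\<integral>\<^sup>+\<omega>. ennreal (\<Sum>i<Suc n. h (X i \<omega>)) * f (\<Sum>i<Suc n. V (X i \<omega>)) \<partial>M) =
    of_nat (Suc n) * (\<integral>\<^sup>+\<omega>0. ennreal (h (X 0 \<omega>0)) *
      (\<integral>\<^sup>+\<omega>. f ((\<Sum>i<n. V (X i \<omega>)) + V (X 0 \<omega>0)) \<partial>M) \<partial>M)"
  using assms(3)
proof (induction n arbitrary: f)
  case 0
  then show ?case by (simp add: emeasure_space_1)
next
  case (Suc n)
  note [measurable] = Suc.prems
  interpret MM: pair_sigma_finite M M ..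
  \<comment> \<open>The pair turns the weight and the argument of \<open>f\<close> into a single
    walk, so both are split by the same step.\<close>
  define W where "W x = (h x, V x)" for x
  have [measurable]: "W \<in> borel_measurable borel" unfolding W_def by (simp add: borel_prod[symmetric])
  have W: "(\<Sum>i<m. W (X i \<omega>)) = (\<Sum>i<m. h (X i \<omega>), \<Sum>i<m. V (X i \<omega>))" for m \<omega>
    by (induction m) (auto simp: W_def zero_prod_def)
  let ?H = "\<lambda>n \<omega>. \<Sum>i<n. h (X i \<omega>)"
  let ?Z = "\<lambda>n \<omega>. \<Sum>i<n. V (X i \<omega>)"
  have Hpos: "?H m \<omega> \<ge> 0" for m \<omega> by (intro sum_nonneg h)
  have g [measurable]: "(\<lambda>z. ennreal (fst z) * f (snd z)) \<in> borel_measurable borel"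
    by (simp add: borel_prod[symmetric])
  have "(\<integral>\<^sup>+\<omega>. ennreal (?H (Suc (Suc n)) \<omega>) * f (?Z (Suc (Suc n)) \<omega>) \<partial>M) =
    (\<integral>\<^sup>+\<omega>. (\<lambda>z. ennreal (fst z) * f (snd z)) (\<Sum>i<Suc (Suc n). W (X i \<omega>)) \<partial>M)"
    by (simp only: W fst_conv snd_conv)
  also have "\<dots> = (\<integral>\<^sup>+\<omega>0. \<integral>\<^sup>+\<omega>. (\<lambda>z. ennreal (fst z) * f (snd z))
      ((\<Sum>i<Suc n. W (X i \<omega>)) + W (X 0 \<omega>0)) \<partial>M \<partial>M)"
    by (rule nn_integral_walk_Suc) measurable
  also have "\<dots> = (\<integral>\<^sup>+\<omega>0. \<integral>\<^sup>+\<omega>. ennreal (?H (Suc n) \<omega> + h (X 0 \<omega>0)) *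
      f (?Z (Suc n) \<omega> + V (X 0 \<omega>0)) \<partial>M \<partial>M)"
    unfolding W by (simp add: W_def del: sum.lessThan_Suc)
  also have "\<dots> = (\<integral>\<^sup>+\<omega>0. (\<integral>\<^sup>+\<omega>. ennreal (?H (Suc n) \<omega>) * f (?Z (Suc n) \<omega> + V (X 0 \<omega>0)) \<partial>M) +
      ennreal (h (X 0 \<omega>0)) * (\<integral>\<^sup>+\<omega>. f (?Z (Suc n) \<omega> + V (X 0 \<omega>0)) \<partial>M) \<partial>M)"
    by (subst ennreal_plus[OF Hpos h])
      (simp add: distrib_right nn_integral_add nn_integral_cmult del: sum.lessThan_Suc)
  also have "\<dots> = (\<integral>\<^sup>+\<omega>0. \<integral>\<^sup>+\<omega>. ennreal (?H (Suc n) \<omega>) * f (?Z (Suc n) \<omega> + V (X 0 \<omega>0)) \<partial>M \<partial>M) +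
     (\<integral>\<^sup>+\<omega>0. ennreal (h (X 0 \<omega>0)) * (\<integral>\<^sup>+\<omega>. f (?Z (Suc n) \<omega> + V (X 0 \<omega>0)) \<partial>M) \<partial>M)"
    by (subst nn_integral_add) (simp_all del: sum.lessThan_Suc)
  \<comment> \<open>Here \<open>\<omega>0\<close> is frozen and \<open>V (X 0 \<omega>0)\<close> is
    absorbed into the integrand; this is why the induction generalises over
    \<open>f\<close>.\<close>
  also have "(\<integral>\<^sup>+\<omega>0. \<integral>\<^sup>+\<omega>. ennreal (?H (Suc n) \<omega>) * f (?Z (Suc n) \<omega> + V (X 0 \<omega>0)) \<partial>M \<partial>M) =
    (\<integral>\<^sup>+\<omega>0. of_nat (Suc n) * (\<integral>\<^sup>+\<omega>1. ennreal (h (X 0 \<omega>1)) *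
      (\<integral>\<^sup>+\<omega>. f ((?Z n \<omega> + V (X 0 \<omega>1)) + V (X 0 \<omega>0)) \<partial>M) \<partial>M) \<partial>M)"
    by (intro nn_integral_cong Suc.IH) measurable
  also have "\<dots> = of_nat (Suc n) * (\<integral>\<^sup>+\<omega>0. (\<integral>\<^sup>+\<omega>1. ennreal (h (X 0 \<omega>1)) *
      (\<integral>\<^sup>+\<omega>. f ((?Z n \<omega> + V (X 0 \<omega>1)) + V (X 0 \<omega>0)) \<partial>M) \<partial>M) \<partial>M)"
    by (rule nn_integral_cmult) measurable
  also have "(\<integral>\<^sup>+\<omega>0. (\<integral>\<^sup>+\<omega>1. ennreal (h (X 0 \<omega>1)) *
      (\<integral>\<^sup>+\<omega>. f ((?Z n \<omega> + V (X 0 \<omega>1)) + V (X 0 \<omega>0)) \<partial>M) \<partial>M) \<partial>M) =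
    (\<integral>\<^sup>+\<omega>1. (\<integral>\<^sup>+\<omega>0. ennreal (h (X 0 \<omega>1)) *
      (\<integral>\<^sup>+\<omega>. f ((?Z n \<omega> + V (X 0 \<omega>1)) + V (X 0 \<omega>0)) \<partial>M) \<partial>M) \<partial>M)"
    by (rule MM.Fubini') measurable
  also have "\<dots> = (\<integral>\<^sup>+\<omega>1. ennreal (h (X 0 \<omega>1)) * (\<integral>\<^sup>+\<omega>0.
      (\<integral>\<^sup>+\<omega>. f ((?Z n \<omega> + V (X 0 \<omega>0)) + V (X 0 \<omega>1)) \<partial>M) \<partial>M) \<partial>M)"
    by (intro nn_integral_cong) (subst nn_integral_cmult[symmetric], measurable, simp add: add_ac)
  \<comment> \<open>With \<open>\<omega>1\<close> outermost, \<open>\<omega>0\<close> plays the role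
    of the new summand and is taken back into the walk.\<close>
  also have "\<dots> = (\<integral>\<^sup>+\<omega>1. ennreal (h (X 0 \<omega>1)) * (\<integral>\<^sup>+\<omega>. f (?Z (Suc n) \<omega> + V (X 0 \<omega>1)) \<partial>M) \<partial>M)"
    by (intro nn_integral_cong arg_cong2[where f="(*)"] refl nn_integral_walk_Suc[symmetric]) measurable
  finally show ?case
    by (simp add: distrib_right add.commute del: sum.lessThan_Suc)
qed

lemma nn_integral_pick_summand_QS:
  fixes h :: "real \<Rightarrow> real"
  assumes [measurable]: "h \<in> borel_measurable borel" "(\<lambda>(q, s). f q s) \<in> borel_measurable (borel \<Otimes>\<^sub>M borel)"
    and h: "\<And>x. h x \<ge> 0"
  shows "(\<integral>\<^sup>+\<omega>. ennreal (\<Sum>i<Suc n. h (X i \<omega>)) * f (Q (Suc n) \<omega>) (S (Suc n) \<omega>) \<partial>M) =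
    of_nat (Suc n) * (\<integral>\<^sup>+\<omega>0. ennreal (h (X 0 \<omega>0)) *
      (\<integral>\<^sup>+\<omega>. f (Q n \<omega> + (X 0 \<omega>0)\<^sup>2) (S n \<omega> + X 0 \<omega>0) \<partial>M) \<partial>M)"
proof -
  have W: "(\<Sum>i<m. ((X i \<omega>)\<^sup>2, X i \<omega>)) = (Q m \<omega>, S m \<omega>)" for m \<omega>
    by (induction m) (auto simp: zero_prod_def Q_def S_def)
  show ?thesis
    using nn_integral_pick_summand[where n=n and h=h and V="\<lambda>x. (x\<^sup>2, x)" and f="\<lambda>(q, s). f q s"]
      assms unfolding W by (simp add: borel_prod[symmetric])
qed

lemma nn_integral_S_Suc:
  assumes [measurable]: "f \<in> borel_measurable borel"
  shows "(\<integral>\<^sup>+\<omega>. f (S (Suc n) \<omega>) \<partial>M) = (\<integral>\<^sup>+\<omega>0. \<integral>\<^sup>+\<omega>. f (S n \<omega> + X 0 \<omega>0) \<partial>M \<partial>M)"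
  using nn_integral_walk_Suc[of "\<lambda>x. x" f n] by (simp add: S_def)

section \<open>Signs and integrability\<close>

lemma integrable_X [simp]: "integrable M (X 0)"
  using sq by (rule square_integrable_imp_integrable[rotated]) simp

lemma a_pos: "a > 0"
proof -
  have "a \<ge> 0" unfolding a_def using pos by (intro integral_nonneg_AE AE_I2) (simp add: less_imp_le)
  moreover have "a \<noteq> 0"
  proof
    assume "a = 0"
    then have "AE \<omega> in M. X 0 \<omega> = 0"
      unfolding a_def using pos by (subst (asm) integral_nonneg_eq_0_iff_AE) (auto intro: less_imp_le)
    moreover have "AE \<omega> in M. X 0 \<omega> > 0" using pos by auto
    ultimately have "AE \<omega> in M. False" by eventually_elim simp
    then show False by simp
  qed
  ultimately show ?thesis by simp
qed

lemma b_nonneg: "b \<ge> 0"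
  unfolding b_def by simp

lemma S_nonneg: "\<omega> \<in> space M \<Longrightarrow> S n \<omega> \<ge> 0"
  unfolding S_def by (intro sum_nonneg) (auto intro: less_imp_le pos)

lemma S_pos: "\<omega> \<in> space M \<Longrightarrow> n > 0 \<Longrightarrow> S n \<omega> > 0"
  unfolding S_def by (intro sum_pos) (auto intro: pos)

lemma Q_nonneg: "Q n \<omega> \<ge> 0"
  unfolding Q_def by (intro sum_nonneg) auto

end

section \<open>Upper bound\<close>

text \<open>After division by \<open>\<theta>\<close> the denominator \<open>D\<close> dominates
  both \<open>max (x / \<theta>) 1\<close> and \<open>max (S / \<theta>) 1\<close>. The
  \<open>j\<close>-th binomial term carries \<open>Suc j\<close> factors
  \<open>x\<^sup>2 / \<theta>\<close>; as many factors of \<open>D\<close> are spent on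
  \<open>x\<close>, turning each into \<open>x\<^sup>2 / max x \<theta>\<close>, and the others are
  kept for \<open>S\<close>. For \<open>j = 0\<close> all of \<open>D\<close> goes to
  \<open>S\<close>, because the main term needs the factor \<open>x\<^sup>2 / \<theta>\<close> with
  its exact mean \<open>b / \<theta>\<close>.\<close>

lemma binomial_remainder_bound:
  fixes x Q S \<theta> :: real
  assumes "x \<ge> 0" "Q \<ge> 0" "S \<ge> 0" "\<theta> > 0" "q < r"
  shows "x\<^sup>2 * (((Q + x\<^sup>2) / \<theta>) ^ q / \<theta> / max ((S + x) / \<theta>) 1 ^ r) \<le>
    x\<^sup>2 / \<theta> * ((Q / \<theta>) ^ q / max (S / \<theta>) 1 ^ r) +
    (\<Sum>j\<in>{1..q}. real (q choose j) * ((x\<^sup>2 / max x \<theta>) ^ Suc j *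
      ((Q / \<theta>) ^ (q - j) / max (S / \<theta>) 1 ^ (r - Suc j))))"
proof -
  define D where "D = max ((S + x) / \<theta>) 1"
  define y where "y = x\<^sup>2 / \<theta>"
  define U where "U = Q / \<theta>"
  have D1: "D \<ge> max (S / \<theta>) 1" "D \<ge> max (x / \<theta>) 1"
    unfolding D_def using assms by (auto simp: divide_right_mono max.coboundedI1)
  have y0: "y \<ge> 0" "U \<ge> 0" unfolding y_def U_def using assms by auto
  have "x\<^sup>2 * (((Q + x\<^sup>2) / \<theta>) ^ q / \<theta> / D ^ r) = y * ((y + U) ^ q / D ^ r)"
    unfolding y_def U_def by (simp add: add_divide_distrib add.commute)
  also have "(y + U) ^ q = (\<Sum>j\<in>{..q}. real (q choose j) * y ^ j * U ^ (q - j))"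
    by (rule binomial_ring)
  also have "\<dots> = U ^ q + (\<Sum>j\<in>{1..q}. real (q choose j) * y ^ j * U ^ (q - j))"
    by (subst atMost_atLeast0, subst sum.atLeast_Suc_atMost) auto
  also have "y * ((U ^ q + (\<Sum>j\<in>{1..q}. real (q choose j) * y ^ j * U ^ (q - j))) / D ^ r) =
    y * (U ^ q / D ^ r) + (\<Sum>j\<in>{1..q}. real (q choose j) * (y ^ Suc j * (U ^ (q - j) / D ^ r)))"
    by (simp add: add_divide_distrib distrib_left sum_divide_distrib sum_distrib_left mult_ac)
  also have "\<dots> \<le> y * (U ^ q / max (S / \<theta>) 1 ^ r) +
    (\<Sum>j\<in>{1..q}. real (q choose j) * ((x\<^sup>2 / max x \<theta>) ^ Suc j *
      (U ^ (q - j) / max (S / \<theta>) 1 ^ (r - Suc j))))"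
  proof (intro add_mono sum_mono mult_left_mono)
    show "U ^ q / D ^ r \<le> U ^ q / max (S / \<theta>) 1 ^ r"
      using D1 y0 by (intro divide_left_mono power_mono) auto
    fix j assume j: "j \<in> {1..q}"
    \<comment> \<open>\<open>q < r\<close> gives \<open>Suc j \<le> r\<close>, so the natural
      subtraction is not cut off at 0.\<close>
    then have r: "r = Suc j + (r - Suc j)" using assms by auto
    have "max (x / \<theta>) 1 ^ Suc j * max (S / \<theta>) 1 ^ (r - Suc j) \<le> D ^ Suc j * D ^ (r - Suc j)"
      using D1 by (intro mult_mono power_mono) auto
    also have "\<dots> = D ^ r" by (subst r, subst power_add) simp
    finally have "y ^ Suc j * (U ^ (q - j) / D ^ r) \<le> y ^ Suc j * (U ^ (q - j) /
        (max (x / \<theta>) 1 ^ Suc j * max (S / \<theta>) 1 ^ (r - Suc j)))"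
      using y0 D1 by (intro mult_left_mono divide_left_mono) auto
    also have "\<dots> = (y / max (x / \<theta>) 1) ^ Suc j * (U ^ (q - j) / max (S / \<theta>) 1 ^ (r - Suc j))"
      by (simp only: power_divide) (simp add: field_simps)
    also have "y / max (x / \<theta>) 1 = x\<^sup>2 / max x \<theta>"
      unfolding y_def using assms by (auto simp: max_def field_simps)
    finally show "y ^ Suc j * (U ^ (q - j) / D ^ r) \<le> (x\<^sup>2 / max x \<theta>) ^ Suc j *
        (U ^ (q - j) / max (S / \<theta>) 1 ^ (r - Suc j))" .
  qed (use y0 in auto)
  finally show ?thesis unfolding y_def D_def U_def .
qed

text \<open>The point 2 is the limit of S / \<open>\<theta>\<close>, and \<open>u \<ge> 1\<close> is
  what the cut-off \<open>max _ 1\<close> supplies. Each further factor \<open>1 / u\<close> is at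
  most \<open>1 / 2 + \<bar>u - 2\<bar>\<close>, and the coefficient \<open>1 / u ^ p\<close> of the
  new deviation is at most 1.\<close>

lemma one_div_power_lipschitz:
  fixes u :: real
  assumes "u \<ge> 1"
  shows "1 / u ^ p \<le> 1 / 2 ^ p + real p * \<bar>u - 2\<bar>"
proof (induction p)
  case (Suc p)
  have h: "1 / u \<le> 1 / 2 + \<bar>u - 2\<bar>"
  proof (cases "u \<le> 2")
    case True
    \<comment> \<open>Cleared of denominators, \<open>1 / u \<le> 1 / 2 + (2 - u)\<close> is exactly
      this inequality.\<close>
    have "0 \<le> (2 - u) * (2 * u - 1)" using True assms by (intro mult_nonneg_nonneg) auto
    then show ?thesis using True assms by (simp add: field_simps)
  next
    case False
    then have "1 / u \<le> 1 / 2" by (intro divide_left_mono) auto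
    then show ?thesis by linarith
  qed
  have "1 / u ^ Suc p = 1 / u ^ p * (1 / u)" by simp
  also have "\<dots> \<le> 1 / u ^ p * (1 / 2 + \<bar>u - 2\<bar>)"
    using assms by (intro mult_left_mono h) auto
  also have "\<dots> = 1 / u ^ p * (1 / 2) + 1 / u ^ p * \<bar>u - 2\<bar>" by (simp add: distrib_left)
  also have "\<dots> \<le> (1 / 2 ^ p + real p * \<bar>u - 2\<bar>) * (1 / 2) + 1 * \<bar>u - 2\<bar>"
    using assms one_le_power[of u p] by (intro add_mono mult_right_mono Suc.IH) (auto simp: field_simps)
  also have "\<dots> \<le> 1 / 2 ^ Suc p + real (Suc p) * \<bar>u - 2\<bar>"
    by (simp add: algebra_simps)
  finally show ?case .
qed simp

text \<open>The product of \<open>1 - y + y^2/2\<close> and \<open>1 + y + y^2/2\<close> equals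
  \<open>1 + y^4/4\<close>, hence is at least 1, and the second factor is at most
  \<open>exp y\<close>.\<close>

lemma exp_minus_le_quadratic:
  fixes y :: real
  assumes "y \<ge> 0"
  shows "exp (- y) \<le> 1 - y + y\<^sup>2 / 2"
proof -
  have "1 \<le> (1 - y + y\<^sup>2 / 2) * (1 + y + y\<^sup>2 / 2)"
    by (simp add: algebra_simps power2_eq_square) (simp flip: mult.assoc power4_eq_xxxx)
  also have "\<dots> \<le> (1 - y + y\<^sup>2 / 2) * exp y"
  proof (rule mult_left_mono)
    show "1 + y + y\<^sup>2 / 2 \<le> exp y" using exp_lower_Taylor_quadratic[OF assms] .
    have "1 - y + y\<^sup>2 / 2 = ((1 - y)\<^sup>2 + 1) / 2" by (simp add: power2_eq_square field_simps)
    then show "0 \<le> 1 - y + y\<^sup>2 / 2" by (simp only:) simp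
  qed
  finally show ?thesis by (simp add: exp_minus field_simps)
qed

section \<open>Recursion for the normalised moments\<close>

context iid_positive begin

text \<open>The exponents are separate because the recursion lowers them differently: its main term
  lowers only \<open>q\<close>, a remainder term lowers \<open>q\<close> and \<open>r\<close> by the
  same amount. So \<open>q \<le> r\<close> persists, and this keeps the values bounded uniformly in
  \<open>m \<le> n\<close>.\<close>

definition H :: "real \<Rightarrow> nat \<Rightarrow> nat \<Rightarrow> nat \<Rightarrow> ennreal" where
  "H \<theta> m q r = (\<integral>\<^sup>+\<omega>. ennreal ((Q m \<omega> / \<theta>) ^ q / max (S m \<omega> / \<theta>) 1 ^ r) \<partial>M)"

text \<open>For positive \<open>x\<close> and \<open>\<theta>\<close>, \<open>x\<^sup>2 / max x \<theta>\<close> is the minimum of \<open>x\<close> and \<open>x\<^sup>2 / \<theta>\<close>.\<close>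
definition jump_moment :: "real \<Rightarrow> nat \<Rightarrow> ennreal" where
  "jump_moment \<theta> j = (\<integral>\<^sup>+\<omega>. ennreal (((X 0 \<omega>)\<^sup>2 / max (X 0 \<omega>) \<theta>) ^ j) \<partial>M)"

lemma H_0_le: "H \<theta> m 0 r \<le> 1"
proof -
  have "H \<theta> m 0 r \<le> (\<integral>\<^sup>+\<omega>. 1 \<partial>M)"
    unfolding H_def by (intro nn_integral_mono) (auto simp: divide_le_eq_1 one_le_power)
  then show ?thesis by (simp add: emeasure_space_1)
qed

text \<open>One factor \<open>Q\<close> of the numerator is expanded as a sum of squares and a
  single summand is picked; \<open>binomial_remainder_bound\<close> then separates that summand from
  the remaining variables, so the double integral factorises.\<close>

lemma H_Suc_le:
  assumes "\<theta> > 0" "q < r"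
  shows "H \<theta> (Suc m) (Suc q) r \<le> of_nat (Suc m) * (ennreal (b / \<theta>) * H \<theta> m q r +
    (\<Sum>j\<in>{1..q}. of_nat (q choose j) * (jump_moment \<theta> (Suc j) * H \<theta> m (q - j) (r - Suc j))))"
proof -
  define G where "G q r \<omega> = (Q m \<omega> / \<theta>) ^ q / max (S m \<omega> / \<theta>) 1 ^ r" for q r \<omega>
  have [measurable]: "G q r \<in> borel_measurable M" for q r
    unfolding G_def by measurable
  have G0: "G q r \<omega> \<ge> 0" for q r \<omega>
    unfolding G_def using assms Q_nonneg by auto
  let ?x = "X 0"
  have "H \<theta> (Suc m) (Suc q) r = (\<integral>\<^sup>+\<omega>. ennreal (\<Sum>i<Suc m. (X i \<omega>)\<^sup>2) *
     ennreal ((Q (Suc m) \<omega> / \<theta>) ^ q / \<theta> / max (S (Suc m) \<omega> / \<theta>) 1 ^ r) \<partial>M)"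
    unfolding H_def
  proof (intro nn_integral_cong)
    fix \<omega>
    show "ennreal ((Q (Suc m) \<omega> / \<theta>) ^ Suc q / max (S (Suc m) \<omega> / \<theta>) 1 ^ r) =
      ennreal (\<Sum>i<Suc m. (X i \<omega>)\<^sup>2) * ennreal ((Q (Suc m) \<omega> / \<theta>) ^ q / \<theta> / max (S (Suc m) \<omega> / \<theta>) 1 ^ r)"
      unfolding Q_def[of "Suc m" \<omega>, symmetric] using assms Q_nonneg
      by (subst ennreal_mult[symmetric]) auto
  qed
  also have "\<dots> = of_nat (Suc m) * (\<integral>\<^sup>+\<omega>0. ennreal ((X 0 \<omega>0)\<^sup>2) *
      (\<integral>\<^sup>+\<omega>. ennreal (((Q m \<omega> + (X 0 \<omega>0)\<^sup>2) / \<theta>) ^ q / \<theta> / max ((S m \<omega> + X 0 \<omega>0) / \<theta>) 1 ^ r) \<partial>M) \<partial>M)"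
    by (rule nn_integral_pick_summand_QS) (simp_all add: split_beta')
  also have "\<dots> \<le> of_nat (Suc m) * (\<integral>\<^sup>+\<omega>0. ennreal ((?x \<omega>0)\<^sup>2 / \<theta>) * H \<theta> m q r +
    (\<Sum>j\<in>{1..q}. of_nat (q choose j) * (ennreal (((?x \<omega>0)\<^sup>2 / max (?x \<omega>0) \<theta>) ^ Suc j) *
       H \<theta> m (q - j) (r - Suc j))) \<partial>M)"
  proof (intro mult_left_mono nn_integral_mono)
    fix \<omega>0 assume \<omega>0: "\<omega>0 \<in> space M"
    let ?X = "X 0 \<omega>0"
    have X0: "?X > 0" using pos \<omega>0 by auto
    have "ennreal (?X\<^sup>2) * (\<integral>\<^sup>+\<omega>. ennreal (((Q m \<omega> + ?X\<^sup>2) / \<theta>) ^ q / \<theta> / max ((S m \<omega> + ?X) / \<theta>) 1 ^ r) \<partial>M)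
      = (\<integral>\<^sup>+\<omega>. ennreal (?X\<^sup>2 * (((Q m \<omega> + ?X\<^sup>2) / \<theta>) ^ q / \<theta> / max ((S m \<omega> + ?X) / \<theta>) 1 ^ r)) \<partial>M)"
      using assms by (subst nn_integral_cmult[symmetric]) (simp_all add: ennreal_mult'[symmetric])
    also have "\<dots> \<le> (\<integral>\<^sup>+\<omega>. ennreal (?X\<^sup>2 / \<theta> * G q r \<omega> +
      (\<Sum>j\<in>{1..q}. real (q choose j) * ((?X\<^sup>2 / max ?X \<theta>) ^ Suc j * G (q - j) (r - Suc j) \<omega>))) \<partial>M)"
      unfolding G_def using assms X0 Q_nonneg S_nonneg
      by (intro nn_integral_mono ennreal_leI binomial_remainder_bound) auto
    also have "\<dots> = (\<integral>\<^sup>+\<omega>. ennreal (?X\<^sup>2 / \<theta>) * ennreal (G q r \<omega>) +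
      (\<Sum>j\<in>{1..q}. of_nat (q choose j) * (ennreal ((?X\<^sup>2 / max ?X \<theta>) ^ Suc j) * ennreal (G (q - j) (r - Suc j) \<omega>))) \<partial>M)"
    proof (intro nn_integral_cong)
      fix \<omega>
      have nn: "0 \<le> real (q choose j) * ((?X\<^sup>2 / max ?X \<theta>) ^ Suc j * G (q - j) (r - Suc j) \<omega>)" for j
        using X0 G0 assms by (intro mult_nonneg_nonneg zero_le_power divide_nonneg_nonneg) auto
      have e: "ennreal (real (q choose j) * ((?X\<^sup>2 / max ?X \<theta>) ^ Suc j * G (q - j) (r - Suc j) \<omega>)) =
        of_nat (q choose j) * (ennreal ((?X\<^sup>2 / max ?X \<theta>) ^ Suc j) * ennreal (G (q - j) (r - Suc j) \<omega>))" for j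
        using X0 G0 assms
        by (simp only: ennreal_mult' ennreal_of_nat_eq_real_of_nat zero_le_power divide_nonneg_nonneg
              zero_le_power2 of_nat_0_le_iff le_max_iff_disj less_imp_le simp_thms)
      show "ennreal (?X\<^sup>2 / \<theta> * G q r \<omega> +
         (\<Sum>j\<in>{1..q}. real (q choose j) * ((?X\<^sup>2 / max ?X \<theta>) ^ Suc j * G (q - j) (r - Suc j) \<omega>))) =
         ennreal (?X\<^sup>2 / \<theta>) * ennreal (G q r \<omega>) +
      (\<Sum>j\<in>{1..q}. of_nat (q choose j) * (ennreal ((?X\<^sup>2 / max ?X \<theta>) ^ Suc j) * ennreal (G (q - j) (r - Suc j) \<omega>)))"
        using assms nn ennreal_mult[OF _ G0[of q r \<omega>], of "?X\<^sup>2 / \<theta>"] G0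
        by (subst ennreal_plus)
          (auto intro!: sum_nonneg divide_nonneg_nonneg mult_nonneg_nonneg
            simp: sum_ennreal[symmetric] e simp del: power_Suc times_divide_eq_left)
    qed
    also have "\<dots> = ennreal (?X\<^sup>2 / \<theta>) * H \<theta> m q r +
      (\<Sum>j\<in>{1..q}. of_nat (q choose j) * (ennreal ((?X\<^sup>2 / max ?X \<theta>) ^ Suc j) * H \<theta> m (q - j) (r - Suc j)))"
      unfolding H_def G_def[symmetric]
      by (simp add: nn_integral_add nn_integral_sum nn_integral_cmult del: power_Suc)
    finally show "ennreal (?X\<^sup>2) * (\<integral>\<^sup>+\<omega>. ennreal (((Q m \<omega> + ?X\<^sup>2) / \<theta>) ^ q / \<theta> / max ((S m \<omega> + ?X) / \<theta>) 1 ^ r) \<partial>M)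
      \<le> ennreal (?X\<^sup>2 / \<theta>) * H \<theta> m q r +
      (\<Sum>j\<in>{1..q}. of_nat (q choose j) * (ennreal ((?X\<^sup>2 / max ?X \<theta>) ^ Suc j) * H \<theta> m (q - j) (r - Suc j)))" .
  qed simp
  also have "(\<integral>\<^sup>+\<omega>0. ennreal ((?x \<omega>0)\<^sup>2 / \<theta>) * H \<theta> m q r +
    (\<Sum>j\<in>{1..q}. of_nat (q choose j) * (ennreal (((?x \<omega>0)\<^sup>2 / max (?x \<omega>0) \<theta>) ^ Suc j) *
       H \<theta> m (q - j) (r - Suc j))) \<partial>M) = (\<integral>\<^sup>+\<omega>0. ennreal ((?x \<omega>0)\<^sup>2 / \<theta>) \<partial>M) * H \<theta> m q r +
    (\<Sum>j\<in>{1..q}. of_nat (q choose j) * (jump_moment \<theta> (Suc j) * H \<theta> m (q - j) (r - Suc j)))"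
    unfolding jump_moment_def
    by (simp add: nn_integral_add nn_integral_sum nn_integral_cmult nn_integral_multc del: power_Suc)
  also have "(\<integral>\<^sup>+\<omega>0. ennreal ((?x \<omega>0)\<^sup>2 / \<theta>) \<partial>M) = ennreal (b / \<theta>)"
    using assms sq by (subst nn_integral_eq_integral) (auto simp: b_def)
  finally show ?thesis .
qed


text \<open>In the application \<open>\<theta> = n a / 2\<close>, so that \<open>\<beta>\<close> does not depend on \<open>n\<close>.\<close>
definition small_jumps :: "nat \<Rightarrow> real \<Rightarrow> real \<Rightarrow> nat \<Rightarrow> real \<Rightarrow> bool" where
  "small_jumps p \<beta> e n \<theta> \<longleftrightarrow> \<theta> > 0 \<and> 0 \<le> e \<and> e \<le> 1 \<and> real n * (b / \<theta>) \<le> \<beta> \<and>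
    (\<forall>j\<in>{2..p}. of_nat n * jump_moment \<theta> j \<le> ennreal e)"

text \<open>The factor \<open>Suc m \<le> n\<close> is distributed: on the main term it meets
  \<open>b / \<theta>\<close> and gives \<open>\<beta>\<close>, on the remainders it meets a jump
  moment and gives \<open>e\<close>. The factor \<open>2 ^ q\<close> bounds the sum of the binomial
  coefficients.\<close>

lemma H_Suc_le_const:
  assumes "small_jumps p \<beta> e n \<theta>" "Suc m \<le> n" "q < r" "r \<le> p"
    and u: "H \<theta> m q r \<le> ennreal u" "u \<ge> 0"
    and K: "K \<ge> 1" "\<And>j. j \<in> {1..q} \<Longrightarrow> H \<theta> m (q - j) (r - Suc j) \<le> ennreal (K ^ (q - j))"
  shows "H \<theta> (Suc m) (Suc q) r \<le> ennreal (\<beta> * u + e * (2 ^ q * K ^ q))"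
proof -
  have th: "\<theta> > 0" and e: "0 \<le> e" and \<beta>: "real n * (b / \<theta>) \<le> \<beta>"
    and J: "\<And>j. j \<in> {2..p} \<Longrightarrow> of_nat n * jump_moment \<theta> j \<le> ennreal e"
    using assms(1) by (auto simp: small_jumps_def)
  have "0 \<le> real n * (b / \<theta>)" using th b_nonneg by auto
  with \<beta> have \<beta>0: "\<beta> \<ge> 0" by linarith
  have "H \<theta> (Suc m) (Suc q) r \<le> of_nat (Suc m) * (ennreal (b / \<theta>) * H \<theta> m q r +
    (\<Sum>j\<in>{1..q}. of_nat (q choose j) * (jump_moment \<theta> (Suc j) * H \<theta> m (q - j) (r - Suc j))))"
    by (rule H_Suc_le) (use th assms in auto)
  also have "\<dots> \<le> of_nat n * (ennreal (b / \<theta>) * H \<theta> m q r +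
    (\<Sum>j\<in>{1..q}. of_nat (q choose j) * (jump_moment \<theta> (Suc j) * H \<theta> m (q - j) (r - Suc j))))"
    using assms(2) by (intro mult_right_mono) (auto simp del: of_nat_Suc)
  also have "\<dots> = (of_nat n * ennreal (b / \<theta>)) * H \<theta> m q r +
    (\<Sum>j\<in>{1..q}. of_nat (q choose j) * ((of_nat n * jump_moment \<theta> (Suc j)) * H \<theta> m (q - j) (r - Suc j)))"
    by (simp add: distrib_left sum_distrib_left mult_ac)
  also have "\<dots> \<le> ennreal \<beta> * ennreal u +
    (\<Sum>j\<in>{1..q}. of_nat (q choose j) * (ennreal e * ennreal (K ^ q)))"
  proof (intro add_mono mult_mono sum_mono u order.refl)
    show "of_nat n * ennreal (b / \<theta>) \<le> ennreal \<beta>"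
      using \<beta> by (simp add: ennreal_of_nat_eq_real_of_nat ennreal_mult'[symmetric] ennreal_leI)
    fix j assume j: "j \<in> {1..q}"
    \<comment> \<open>From \<open>q < r \<le> p\<close> the index \<open>Suc j\<close> lies in
      \<open>{2..p}\<close>, the range covered by \<open>small_jumps\<close>.\<close>
    show "of_nat n * jump_moment \<theta> (Suc j) \<le> ennreal e" using j assms by (intro J) auto
    have "H \<theta> m (q - j) (r - Suc j) \<le> ennreal (K ^ (q - j))" by (rule K(2)) fact
    also have "\<dots> \<le> ennreal (K ^ q)" using K(1) by (intro ennreal_leI power_increasing) auto
    finally show "H \<theta> m (q - j) (r - Suc j) \<le> ennreal (K ^ q)" .
  qed auto
  also have "\<dots> = ennreal (\<beta> * u + (\<Sum>j\<in>{1..q}. real (q choose j) * (e * K ^ q)))"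
    using \<beta>0 u e K(1)
    by (subst ennreal_plus)
      (auto intro!: sum_nonneg simp: ennreal_of_nat_eq_real_of_nat ennreal_mult'[symmetric] sum_ennreal)
  also have "\<dots> \<le> ennreal (\<beta> * u + e * (2 ^ q * K ^ q))"
  proof (intro ennreal_leI add_left_mono)
    have "(\<Sum>j\<in>{1..q}. real (q choose j)) \<le> (\<Sum>j\<in>{..q}. real (q choose j))"
      by (intro sum_mono2) auto
    also have "\<dots> = 2 ^ q" by (simp flip: of_nat_sum add: choose_row_sum)
    finally have "(\<Sum>j\<in>{1..q}. real (q choose j)) * (e * K ^ q) \<le> 2 ^ q * (e * K ^ q)"
      using e K(1) by (intro mult_right_mono) auto
    then show "(\<Sum>j\<in>{1..q}. real (q choose j) * (e * K ^ q)) \<le> e * (2 ^ q * K ^ q)"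
      unfolding sum_distrib_right[symmetric] by (simp only: mult_ac)
  qed
  finally show ?thesis .
qed

text \<open>A bound independent of \<open>n\<close>, to be used for the remainders, which already
  carry the small factor \<open>e\<close>. Strong induction is used because a remainder can jump to
  any smaller \<open>q\<close>. The base \<open>K = 1 + \<beta> + 2 ^ p\<close> is chosen so that
  \<open>\<beta> * K ^ q + e * 2 ^ q * K ^ q \<le> K ^ Suc q\<close> when \<open>e \<le> 1\<close>
  and \<open>q \<le> p\<close>.\<close>

lemma H_le_power:
  assumes sj: "small_jumps p \<beta> e n \<theta>" and "m \<le> n" "q \<le> r" "r \<le> p"
  shows "H \<theta> m q r \<le> ennreal ((1 + \<beta> + 2 ^ p) ^ q)"
  using assms(2-)
proof (induction q arbitrary: m r rule: less_induct)
  case (less q)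
  define K where "K = 1 + \<beta> + 2 ^ p"
  have "0 \<le> real n * (b / \<theta>)" using sj b_nonneg by (auto simp: small_jumps_def)
  then have \<beta>0: "\<beta> \<ge> 0" and e: "0 \<le> e" "e \<le> 1" using sj by (auto simp: small_jumps_def)
  then have K1: "K \<ge> 1" unfolding K_def by simp
  show ?case
  proof (cases "q = 0 \<or> m = 0")
    case True
    then have "H \<theta> m q r \<le> 1"
    proof
      assume "m = 0"
      then show ?thesis unfolding H_def
        by (cases "q = 0") (auto simp: Q_def S_def emeasure_space_1 power_0_left)
    qed (simp add: H_0_le)
    also have "1 \<le> ennreal (K ^ q)" using K1 by (simp add: one_le_power)
    finally show ?thesis unfolding K_def .
  next
    case False
    then obtain m' q' where mq: "m = Suc m'" "q = Suc q'" by (cases m; cases q) auto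
    have "H \<theta> (Suc m') (Suc q') r \<le> ennreal (\<beta> * K ^ q' + e * (2 ^ q' * K ^ q'))"
    proof (rule H_Suc_le_const[OF sj])
      show "H \<theta> m' q' r \<le> ennreal (K ^ q')"
        unfolding K_def using less.prems mq by (intro less.IH) auto
      fix j assume "j \<in> {1..q'}"
      then show "H \<theta> m' (q' - j) (r - Suc j) \<le> ennreal (K ^ (q' - j))"
        unfolding K_def using less.prems mq by (intro less.IH) auto
    qed (use K1 less.prems mq in auto)
    also have "\<dots> \<le> ennreal (K ^ q)"
    proof (intro ennreal_leI)
      have "e * (2 ^ q' * K ^ q') \<le> 1 * (2 ^ p * K ^ q')"
        using e K1 less.prems mq by (intro mult_mono power_increasing) auto
      then have "\<beta> * K ^ q' + e * (2 ^ q' * K ^ q') \<le> (\<beta> + 2 ^ p) * K ^ q'" by (simp add: algebra_simps)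
      also have "\<dots> \<le> K * K ^ q'" using K1 unfolding K_def by (intro mult_right_mono) auto
      finally show "\<beta> * K ^ q' + e * (2 ^ q' * K ^ q') \<le> K ^ q" using mq by simp
    qed
    finally show ?thesis unfolding K_def mq .
  qed
qed

text \<open>Only the main branch of the recursion is followed, along which \<open>r\<close> stays
  equal to \<open>p\<close>; each of its \<open>q\<close> steps multiplies by \<open>\<beta>\<close>
  and adds a remainder already bounded by \<open>H_le_power\<close>. The branch ends at a pure
  negative moment with \<open>m\<close> variables.\<close>

lemma H_le_main_term:
  assumes sj: "small_jumps p \<beta> e n \<theta>" and "m + q \<le> n" "q \<le> p"
    and \<rho>: "H \<theta> m 0 p \<le> ennreal \<rho>" "\<rho> \<ge> 0"
  shows "H \<theta> (m + q) q p \<le> ennreal (\<beta> ^ q * \<rho> + e * (real q * (1 + \<beta> + 2 ^ p) ^ q))"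
  using assms(2-3)
proof (induction q)
  case 0
  then show ?case using \<rho> by simp
next
  case (Suc q)
  define K where "K = 1 + \<beta> + 2 ^ p"
  have "0 \<le> real n * (b / \<theta>)" using sj b_nonneg by (auto simp: small_jumps_def)
  then have \<beta>0: "\<beta> \<ge> 0" and e: "0 \<le> e" "e \<le> 1" using sj by (auto simp: small_jumps_def)
  then have K1: "K \<ge> 1" unfolding K_def by simp
  let ?u = "\<beta> ^ q * \<rho> + e * (real q * K ^ q)"
  have "H \<theta> (Suc (m + q)) (Suc q) p \<le> ennreal (\<beta> * ?u + e * (2 ^ q * K ^ q))"
  proof (rule H_Suc_le_const[OF sj])
    show "H \<theta> (m + q) q p \<le> ennreal ?u" unfolding K_def using Suc by auto
    show "0 \<le> ?u" using \<beta>0 e \<rho> K1 by auto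
    fix j assume "j \<in> {1..q}"
    then show "H \<theta> (m + q) (q - j) (p - Suc j) \<le> ennreal (K ^ (q - j))"
      unfolding K_def using Suc.prems by (intro H_le_power[OF sj]) auto
  qed (use K1 Suc.prems in auto)
  also have "\<dots> \<le> ennreal (\<beta> ^ Suc q * \<rho> + e * (real (Suc q) * K ^ Suc q))"
  proof (intro ennreal_leI)
    have "2 ^ q * K ^ q \<le> 2 ^ p * K ^ q"
      using Suc.prems K1 by (intro mult_right_mono power_increasing) auto
    also have "\<dots> \<le> K * K ^ q" using K1 \<beta>0 unfolding K_def by (intro mult_right_mono) auto
    finally have 1: "2 ^ q * K ^ q \<le> K * K ^ q" .
    have 2: "\<beta> * (real q * K ^ q) \<le> K * (real q * K ^ q)"
      using K1 unfolding K_def by (intro mult_right_mono) auto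
    have "e * (\<beta> * (real q * K ^ q) + 2 ^ q * K ^ q) \<le> e * (K * (real q * K ^ q) + K * K ^ q)"
      using 1 2 e by (intro mult_left_mono) auto
    then show "\<beta> * ?u + e * (2 ^ q * K ^ q) \<le> \<beta> ^ Suc q * \<rho> + e * (real (Suc q) * K ^ Suc q)"
      by (simp add: algebra_simps)
  qed
  finally show ?case unfolding K_def by simp
qed

section \<open>Deviation of the sum from its mean\<close>

lemma moments_X: "integrable M (X n)" "expectation (X n) = a" "integrable M (\<lambda>\<omega>. (X n \<omega>)\<^sup>2)"
  "expectation (\<lambda>\<omega>. (X n \<omega>)\<^sup>2) = b"
proof -
  have i: "integrable (distr M borel (X i)) f \<longleftrightarrow> integrable M (\<lambda>\<omega>. f (X i \<omega>))"
    if "f \<in> borel_measurable borel" for i and f :: "real \<Rightarrow> real"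
    using that by (subst integrable_distr_eq) auto
  have j: "integral\<^sup>L (distr M borel (X i)) f = expectation (\<lambda>\<omega>. f (X i \<omega>))"
    if "f \<in> borel_measurable borel" for i and f :: "real \<Rightarrow> real"
    using that by (subst integral_distr) auto
  show "integrable M (X n)" using i[of "\<lambda>x. x" n] i[of "\<lambda>x. x" 0] ident[of n] by simp
  show "integrable M (\<lambda>\<omega>. (X n \<omega>)\<^sup>2)" using i[of "\<lambda>x. x\<^sup>2" n] i[of "\<lambda>x. x\<^sup>2" 0] ident[of n] sq by simp
  show "expectation (X n) = a"
    using j[of "\<lambda>x. x" n] j[of "\<lambda>x. x" 0] ident[of n] by (simp add: a_def)
  show "expectation (\<lambda>\<omega>. (X n \<omega>)\<^sup>2) = b"
    using j[of "\<lambda>x. x\<^sup>2" n] j[of "\<lambda>x. x\<^sup>2" 0] ident[of n] by (simp add: b_def)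
qed

text \<open>The cross terms vanish by independence, and each variance \<open>b - a\<^sup>2\<close>
  is at most \<open>b\<close>. Integrability is carried along because the induction step relies on
  it.\<close>

lemma expectation_sq_deviation_le: "expectation (\<lambda>\<omega>. (S n \<omega> - real n * a)\<^sup>2) \<le> real n * b
    \<and> integrable M (\<lambda>\<omega>. (S n \<omega> - real n * a)\<^sup>2)"
proof (induction n)
  case 0
  then show ?case by (simp add: S_def)
next
  case (Suc n)
  note X = moments_X[of n]
  let ?Y = "\<lambda>\<omega>. X n \<omega> - a" and ?Z = "\<lambda>\<omega>. S n \<omega> - real n * a"
  have "indep_var borel (X n) borel (\<lambda>\<omega>. \<Sum>i<n. X i \<omega>)"
    by (rule indep_vars_sum) (auto intro: indep_vars_subset[OF indep])
  then have "indep_var borel (X n) borel (S n)" by (simp add: S_def[abs_def])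
  from indep_var_compose[OF this, of "\<lambda>x. x - a" borel "\<lambda>x. x - real n * a" borel] have ind: "indep_var borel ?Y borel ?Z" by (simp add: o_def)
  have Z2: "integrable M (\<lambda>\<omega>. (?Z \<omega>)\<^sup>2)" using Suc by simp
  then have Z: "integrable M ?Z" by (rule square_integrable_imp_integrable[rotated]) simp
  have Y: "integrable M ?Y" using X by auto
  have Y2: "integrable M (\<lambda>\<omega>. (?Y \<omega>)\<^sup>2)"
    using X by (auto simp: power2_diff)
  have YZ: "integrable M (\<lambda>\<omega>. ?Y \<omega> * ?Z \<omega>)" "expectation (\<lambda>\<omega>. ?Y \<omega> * ?Z \<omega>) = 0"
    using indep_var_integrable[OF ind Y Z] indep_var_lebesgue_integral[OF ind Y Z] X by (auto simp: prob_space)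
  have e: "(S (Suc n) \<omega> - real (Suc n) * a)\<^sup>2 = (?Z \<omega>)\<^sup>2 + 2 * (?Y \<omega> * ?Z \<omega>) + (?Y \<omega>)\<^sup>2" for \<omega>
    by (simp add: S_def power2_eq_square algebra_simps)
  have "expectation (\<lambda>\<omega>. (?Y \<omega>)\<^sup>2) = b - a\<^sup>2"
    using variance_eq[OF X(1) X(3)] X by simp
  then have "expectation (\<lambda>\<omega>. (?Y \<omega>)\<^sup>2) \<le> b" by simp
  then show ?case unfolding e using Suc YZ Y2 by (simp add: distrib_right)
qed

lemma expectation_deviation_le: "integrable M (\<lambda>\<omega>. \<bar>S n \<omega> - real n * a\<bar>)"
    "expectation (\<lambda>\<omega>. \<bar>S n \<omega> - real n * a\<bar>) \<le> sqrt (real n * b)"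
proof -
  let ?Z = "\<lambda>\<omega>. S n \<omega> - real n * a"
  have Z2: "integrable M (\<lambda>\<omega>. (?Z \<omega>)\<^sup>2)" using expectation_sq_deviation_le by simp
  then have Z: "integrable M ?Z" by (rule square_integrable_imp_integrable[rotated]) simp
  then show 1: "integrable M (\<lambda>\<omega>. \<bar>?Z \<omega>\<bar>)" by simp
  \<comment> \<open>Nonnegativity of this variance is the Cauchy-Schwarz inequality in the form
    needed here.\<close>
  have "0 \<le> variance (\<lambda>\<omega>. \<bar>?Z \<omega>\<bar>)" by (rule variance_positive)
  also have "\<dots> = expectation (\<lambda>\<omega>. \<bar>?Z \<omega>\<bar>\<^sup>2) - (expectation (\<lambda>\<omega>. \<bar>?Z \<omega>\<bar>))\<^sup>2"
    using 1 Z2 by (intro variance_eq) auto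
  finally have "(expectation (\<lambda>\<omega>. \<bar>?Z \<omega>\<bar>))\<^sup>2 \<le> real n * b"
    using expectation_sq_deviation_le[of n] by simp
  then show "expectation (\<lambda>\<omega>. \<bar>?Z \<omega>\<bar>) \<le> sqrt (real n * b)"
    by (rule real_le_rsqrt)
qed

text \<open>The Lipschitz bound at 2 reduces the claim to the mean deviation of \<open>S m\<close>,
  of order \<open>sqrt n\<close>, relative to \<open>\<theta>\<close>, of order \<open>n\<close>.
  This is one source of the rate \<open>1 / sqrt n\<close>.\<close>

lemma H_0_le_limit:
  assumes "n > 0" "m \<le> n" "n \<le> m + p"
  shows "H (real n * a / 2) m 0 p \<le>
    ennreal (1 / 2 ^ p + real p * (2 * (real p * a + sqrt b) / a) / sqrt (real n))"
proof -
  let ?\<theta> = "real n * a / 2"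
  let ?Z = "\<lambda>\<omega>. \<bar>S m \<omega> - real m * a\<bar>"
  have th: "?\<theta> > 0" using assms a_pos by auto
  have "H ?\<theta> m 0 p \<le> (\<integral>\<^sup>+\<omega>. ennreal (1 / 2 ^ p + real p * ((?Z \<omega> + real p * a) / ?\<theta>)) \<partial>M)"
    unfolding H_def
  proof (intro nn_integral_mono ennreal_leI)
    fix \<omega>
    let ?u = "max (S m \<omega> / ?\<theta>) 1"
    have "1 / ?u ^ p \<le> 1 / 2 ^ p + real p * \<bar>?u - 2\<bar>"
      by (rule one_div_power_lipschitz) simp
    also have "\<bar>?u - 2\<bar> \<le> \<bar>S m \<omega> / ?\<theta> - 2\<bar>" by (simp add: max_def)
    also have "S m \<omega> / ?\<theta> - 2 = (S m \<omega> - real n * a) / ?\<theta>"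
      using assms a_pos by (simp add: field_simps)
    also have "\<bar>\<dots>\<bar> = \<bar>S m \<omega> - real n * a\<bar> / ?\<theta>" using th by (simp only: abs_divide abs_of_pos)
    \<comment> \<open>At most \<open>p\<close> summands have been removed, so recentring from
      \<open>real m * a\<close> to \<open>real n * a\<close> costs at most
      \<open>real p * a\<close>.\<close>
    also have "\<dots> \<le> (?Z \<omega> + real p * a) / ?\<theta>"
    proof (intro divide_right_mono)
      have "real n \<le> real m + real p" "real m \<le> real n" using assms by linarith+
      then have "real n * a \<le> (real m + real p) * a" "real m * a \<le> real n * a"
        using a_pos by (auto intro: mult_right_mono)
      then show "\<bar>S m \<omega> - real n * a\<bar> \<le> ?Z \<omega> + real p * a" by (simp add: algebra_simps)
    qed (use th in auto)
    finally show "(Q m \<omega> / ?\<theta>) ^ 0 / ?u ^ p \<le> 1 / 2 ^ p + real p * ((?Z \<omega> + real p * a) / ?\<theta>)"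
      by (simp add: mult_left_mono)
  qed
  also have "\<dots> = ennreal (1 / 2 ^ p + real p * ((expectation ?Z + real p * a) / ?\<theta>))"
    using expectation_deviation_le(1)[of m] th a_pos
    by (subst nn_integral_eq_integral) (auto simp: prob_space add_divide_distrib)
  also have "\<dots> \<le> ennreal (1 / 2 ^ p + real p * ((sqrt (real n * b) + real p * a * sqrt (real n)) / ?\<theta>))"
  proof (intro ennreal_leI add_left_mono mult_left_mono divide_right_mono add_mono)
    have "expectation ?Z \<le> sqrt (real m * b)" by (rule expectation_deviation_le)
    also have "\<dots> \<le> sqrt (real n * b)" using assms b_nonneg by (simp add: mult_right_mono)
    finally show "expectation ?Z \<le> sqrt (real n * b)" .
    show "real p * a \<le> real p * a * sqrt (real n)"
      using assms a_pos mult_left_mono[of 1 "sqrt (real n)" "real p * a"] by simp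
  qed (use th in auto)
  also have "1 / 2 ^ p + real p * ((sqrt (real n * b) + real p * a * sqrt (real n)) / ?\<theta>) =
    1 / 2 ^ p + real p * (2 * (real p * a + sqrt b) / a) / sqrt (real n)"
  proof -
    have "(s * B + y * s) / (s * s * a / 2) = 2 * (y + B) / a / s" if "s > 0" for s B y :: real
      using that a_pos by (simp add: field_simps)
    from this[of "sqrt (real n)" "sqrt b" "real p * a"] show ?thesis
      using assms by (simp add: real_sqrt_mult)
  qed
  finally show ?thesis .
qed


section \<open>Exponential bound for a small sum\<close>

definition P_small :: "real \<Rightarrow> nat \<Rightarrow> ennreal" where
  "P_small \<theta> m = emeasure M {\<omega>\<in>space M. S m \<omega> < \<theta>}"

lemma b_pos: "b > 0"
proof -
  have "0 \<le> variance (X 0)" by (rule variance_positive)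
  also have "variance (X 0) = b - a\<^sup>2"
    unfolding b_def a_def by (rule variance_eq) (use sq in auto)
  finally have "a\<^sup>2 \<le> b" by simp
  moreover have "a\<^sup>2 > 0" using a_pos by simp
  ultimately show ?thesis by linarith
qed

text \<open>For one variable, \<open>exp (- y) \<le> 1 - y + y\<^sup>2 / 2\<close> followed by
  \<open>1 + z \<le> exp z\<close> gives the bound in terms of \<open>a\<close> and
  \<open>b\<close>; independence multiplies the factors. Positivity of the variables is what makes
  the second moment control the lower tail exponentially.\<close>

lemma laplace_S_le:
  assumes "t \<ge> 0"
  shows "(\<integral>\<^sup>+\<omega>. ennreal (exp (- t * S m \<omega>)) \<partial>M) \<le> ennreal (exp (- real m * (t * a - t\<^sup>2 * b / 2)))"
proof (induction m)
  case 0
  then show ?case by (simp add: S_def emeasure_space_1)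
next
  case (Suc m)
  let ?l = "t * a - t\<^sup>2 * b / 2"
  have "(\<integral>\<^sup>+\<omega>. ennreal (exp (- t * X 0 \<omega>)) \<partial>M) \<le> (\<integral>\<^sup>+\<omega>. ennreal (1 - t * X 0 \<omega> + (t * X 0 \<omega>)\<^sup>2 / 2) \<partial>M)"
  proof (intro nn_integral_mono ennreal_leI)
    fix \<omega> assume "\<omega> \<in> space M"
    then have "t * X 0 \<omega> \<ge> 0" using assms pos[of \<omega> 0] by auto
    from exp_minus_le_quadratic[OF this]
    show "exp (- t * X 0 \<omega>) \<le> 1 - t * X 0 \<omega> + (t * X 0 \<omega>)\<^sup>2 / 2" by simp
  qed
  also have "\<dots> = ennreal (expectation (\<lambda>\<omega>. 1 - t * X 0 \<omega> + (t * X 0 \<omega>)\<^sup>2 / 2))"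
  proof (intro nn_integral_eq_integral AE_I2)
    show "integrable M (\<lambda>\<omega>. 1 - t * X 0 \<omega> + (t * X 0 \<omega>)\<^sup>2 / 2)"
      using sq by (simp add: power_mult_distrib)
    show "0 \<le> 1 - t * X 0 \<omega> + (t * X 0 \<omega>)\<^sup>2 / 2" for \<omega>
    proof -
      have "1 - y + y\<^sup>2 / 2 = ((1 - y)\<^sup>2 + 1) / 2" for y :: real by (simp add: power2_eq_square field_simps)
      then show ?thesis by (simp only:) simp
    qed
  qed
  also have "expectation (\<lambda>\<omega>. 1 - t * X 0 \<omega> + (t * X 0 \<omega>)\<^sup>2 / 2) = 1 - ?l"
    using sq by (simp add: power_mult_distrib prob_space a_def b_def)
  also have "ennreal (1 - ?l) \<le> ennreal (exp (- ?l))"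
    using exp_ge_add_one_self[of "- ?l"] by (intro ennreal_leI) (simp only: diff_conv_add_uminus)
  finally have L: "(\<integral>\<^sup>+\<omega>. ennreal (exp (- t * X 0 \<omega>)) \<partial>M) \<le> ennreal (exp (- ?l))" .
  have "(\<integral>\<^sup>+\<omega>. ennreal (exp (- t * S (Suc m) \<omega>)) \<partial>M) =
    (\<integral>\<^sup>+\<omega>0. \<integral>\<^sup>+\<omega>. ennreal (exp (- t * (S m \<omega> + X 0 \<omega>0))) \<partial>M \<partial>M)"
    by (rule nn_integral_S_Suc) simp
  also have "\<dots> = (\<integral>\<^sup>+\<omega>0. ennreal (exp (- t * X 0 \<omega>0)) * (\<integral>\<^sup>+\<omega>. ennreal (exp (- t * S m \<omega>)) \<partial>M) \<partial>M)"
    by (intro nn_integral_cong)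
      (subst nn_integral_cmult[symmetric], auto simp: algebra_simps exp_diff exp_minus divide_simps
        simp flip: ennreal_mult)
  also have "\<dots> = (\<integral>\<^sup>+\<omega>0. ennreal (exp (- t * X 0 \<omega>0)) \<partial>M) * (\<integral>\<^sup>+\<omega>. ennreal (exp (- t * S m \<omega>)) \<partial>M)"
    by (rule nn_integral_multc) simp
  also have "\<dots> \<le> ennreal (exp (- ?l)) * ennreal (exp (- real m * ?l))"
    by (intro mult_mono L Suc.IH) auto
  also have "\<dots> = ennreal (exp (- real (Suc m) * ?l))"
    by (simp add: field_simps flip: ennreal_mult exp_add)
  finally show ?case .
qed

text \<open>A Chernoff bound. The level is half the mean of \<open>Suc m\<close> variables, while
  only \<open>m\<close> remain after one has been picked; the missing variable accounts for the
  constant factor \<open>exp (3 * a\<^sup>2 / (8 * b))\<close>.\<close>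

lemma P_small_le:
  "P_small (real (Suc m) * a / 2) m \<le>
    ennreal (exp (3 * a\<^sup>2 / (8 * b)) * exp (- real (Suc m) * (a\<^sup>2 / (8 * b))))"
proof -
  \<comment> \<open>The minimiser of \<open>- t * a / 2 + t\<^sup>2 * b / 2\<close>, the exponent
    per variable; the minimum is \<open>- a\<^sup>2 / (8 * b)\<close>.\<close>
  define t where "t = a / (2 * b)"
  let ?\<theta> = "real (Suc m) * a / 2"
  have t: "t > 0" unfolding t_def using a_pos b_pos by auto
  have "P_small ?\<theta> m = (\<integral>\<^sup>+\<omega>. indicator {\<omega>\<in>space M. S m \<omega> < ?\<theta>} \<omega> \<partial>M)"
    unfolding P_small_def by (subst nn_integral_indicator) auto
  also have "\<dots> \<le> (\<integral>\<^sup>+\<omega>. ennreal (exp (t * ?\<theta>)) * ennreal (exp (- t * S m \<omega>)) \<partial>M)"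
  proof (intro nn_integral_mono)
    fix \<omega>
    show "indicator {\<omega> \<in> space M. S m \<omega> < ?\<theta>} \<omega> \<le> ennreal (exp (t * ?\<theta>)) * ennreal (exp (- t * S m \<omega>))"
      using t by (auto simp: indicator_def mult_left_mono simp flip: ennreal_mult exp_add simp del: of_nat_Suc)
  qed
  also have "\<dots> = ennreal (exp (t * ?\<theta>)) * (\<integral>\<^sup>+\<omega>. ennreal (exp (- t * S m \<omega>)) \<partial>M)"
    by (rule nn_integral_cmult) simp
  also have "\<dots> \<le> ennreal (exp (t * ?\<theta>)) * ennreal (exp (- real m * (t * a - t\<^sup>2 * b / 2)))"
    using t by (intro mult_left_mono laplace_S_le) auto
  also have "\<dots> = ennreal (exp (t * ?\<theta> - real m * (t * a - t\<^sup>2 * b / 2)))"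
    by (simp flip: ennreal_mult exp_add)
  also have "t * ?\<theta> - real m * (t * a - t\<^sup>2 * b / 2) = 3 * a\<^sup>2 / (8 * b) - real (Suc m) * (a\<^sup>2 / (8 * b))"
    unfolding t_def using b_pos by (simp add: field_simps power2_eq_square)
  finally show ?thesis by (simp flip: exp_add del: of_nat_Suc)
qed

section \<open>Upper bound for the moments of the statistic\<close>

text \<open>\<open>Q / S\<close> is the average of the \<open>X i\<close> with weights
  \<open>X i / S\<close>, hence at most their maximum, whose power is one of the summands on the
  right. No lower bound on \<open>S\<close> enters.\<close>

lemma T_power_le_sum:
  assumes "\<omega> \<in> space M" "n > 0"
  shows "(Q n \<omega> / S n \<omega>) ^ p \<le> (\<Sum>i<n. (X i \<omega>) ^ p)"
proof -
  define m where "m = Max ((\<lambda>i. X i \<omega>) ` {..<n})"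
  have "m \<in> (\<lambda>i. X i \<omega>) ` {..<n}" unfolding m_def using assms by (intro Max_in) auto
  then obtain k where k: "k < n" "m = X k \<omega>" by auto
  have le: "X i \<omega> \<le> m" if "i < n" for i unfolding m_def using that by (intro Max_ge) auto
  have p: "X i \<omega> > 0" for i using assms pos by auto
  have "Q n \<omega> \<le> (\<Sum>i<n. m * X i \<omega>)"
    unfolding Q_def power2_eq_square using le p by (intro sum_mono mult_right_mono) (auto intro: less_imp_le)
  also have "\<dots> = m * S n \<omega>" by (simp add: S_def sum_distrib_left)
  finally have "Q n \<omega> / S n \<omega> \<le> m" using S_pos[OF assms] by (simp add: field_simps)
  then have "(Q n \<omega> / S n \<omega>) ^ p \<le> X k \<omega> ^ p"
    using Q_nonneg S_nonneg[OF assms(1)] k by (intro power_mono) auto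
  also have "\<dots> \<le> (\<Sum>i<n. (X i \<omega>) ^ p)"
    using k p by (intro member_le_sum) (auto intro: less_imp_le)
  finally show ?thesis .
qed

lemma T_stat_eq: "T_stat X n \<omega> = Q n \<omega> / S n \<omega>"
  by (simp add: T_stat_def Q_def S_def)

text \<open>With values in \<open>ennreal\<close> a divergent expectation stays infinite instead of
  receiving the default value 0 of the Bochner integral.\<close>

definition ET :: "nat \<Rightarrow> nat \<Rightarrow> ennreal" where
  "ET p n = (\<integral>\<^sup>+\<omega>. ennreal (T_stat X n \<omega> ^ p) \<partial>M)"

text \<open>Where \<open>S\<close> is at least \<open>\<theta>\<close> the cut-off changes nothing.
  Where it is smaller, \<open>T_power_le_sum\<close> applies; after picking one summand, the event
  for the full sum lies in the event for the other \<open>m\<close> variables, which is independent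
  of that summand.\<close>

lemma ET_le_H:
  assumes "\<theta> > 0"
  shows "ET p (Suc m) \<le> H \<theta> (Suc m) p p +
    of_nat (Suc m) * ((\<integral>\<^sup>+\<omega>. ennreal (X 0 \<omega> ^ p) \<partial>M) * P_small \<theta> m)"
proof -
  let ?n = "Suc m"
  let ?I = "\<lambda>s. indicator {..<\<theta>} s :: ennreal"
  \<comment> \<open>The absolute values make the weight nonnegative on the whole line, as required
    for picking a summand.\<close>
  have "ET p ?n \<le> (\<integral>\<^sup>+\<omega>. ennreal ((Q ?n \<omega> / \<theta>) ^ p / max (S ?n \<omega> / \<theta>) 1 ^ p) +
     ennreal (\<Sum>i<?n. \<bar>X i \<omega>\<bar> ^ p) * ?I (S ?n \<omega>) \<partial>M)"
    unfolding ET_def T_stat_eq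
  proof (intro nn_integral_mono)
    fix \<omega> assume \<omega>: "\<omega> \<in> space M"
    show "ennreal ((Q ?n \<omega> / S ?n \<omega>) ^ p) \<le> ennreal ((Q ?n \<omega> / \<theta>) ^ p / max (S ?n \<omega> / \<theta>) 1 ^ p) +
       ennreal (\<Sum>i<?n. \<bar>X i \<omega>\<bar> ^ p) * ?I (S ?n \<omega>)"
    proof (cases "S ?n \<omega> < \<theta>")
      case True
      have "ennreal ((Q ?n \<omega> / S ?n \<omega>) ^ p) \<le> ennreal (\<Sum>i<?n. (X i \<omega>) ^ p)"
        using \<omega> by (intro ennreal_leI T_power_le_sum) auto
      also have "(\<Sum>i<?n. (X i \<omega>) ^ p) = (\<Sum>i<?n. \<bar>X i \<omega>\<bar> ^ p)"
        using \<omega> pos by (intro sum.cong) (auto simp: less_imp_le)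
      finally show ?thesis using True by (simp del: sum.lessThan_Suc add: add_increasing)
    next
      case False
      then have "(Q ?n \<omega> / S ?n \<omega>) ^ p = (Q ?n \<omega> / \<theta>) ^ p / max (S ?n \<omega> / \<theta>) 1 ^ p"
        using assms by (simp add: max_def field_simps flip: power_divide)
      then show ?thesis by simp
    qed
  qed
  also have "\<dots> = H \<theta> ?n p p + (\<integral>\<^sup>+\<omega>. ennreal (\<Sum>i<?n. \<bar>X i \<omega>\<bar> ^ p) * ?I (S ?n \<omega>) \<partial>M)"
    unfolding H_def by (subst nn_integral_add) (auto simp del: sum.lessThan_Suc)
  also have "(\<integral>\<^sup>+\<omega>. ennreal (\<Sum>i<?n. \<bar>X i \<omega>\<bar> ^ p) * ?I (S ?n \<omega>) \<partial>M) =
    of_nat ?n * (\<integral>\<^sup>+\<omega>0. ennreal (\<bar>X 0 \<omega>0\<bar> ^ p) * (\<integral>\<^sup>+\<omega>. ?I (S m \<omega> + X 0 \<omega>0) \<partial>M) \<partial>M)"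
    by (rule nn_integral_pick_summand_QS) (simp_all add: split_beta')
  also have "\<dots> \<le> of_nat ?n * (\<integral>\<^sup>+\<omega>0. ennreal (X 0 \<omega>0 ^ p) * P_small \<theta> m \<partial>M)"
  proof (intro mult_left_mono nn_integral_mono mult_mono)
    fix \<omega>0 assume \<omega>0: "\<omega>0 \<in> space M"
    show "ennreal (\<bar>X 0 \<omega>0\<bar> ^ p) \<le> ennreal (X 0 \<omega>0 ^ p)" using pos[OF \<omega>0, of 0] by simp
    have "(\<integral>\<^sup>+\<omega>. ?I (S m \<omega> + X 0 \<omega>0) \<partial>M) \<le> (\<integral>\<^sup>+\<omega>. indicator {\<omega>\<in>space M. S m \<omega> < \<theta>} \<omega> \<partial>M)"
      using pos[OF \<omega>0, of 0] by (intro nn_integral_mono) (auto simp: indicator_def)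
    also have "\<dots> = P_small \<theta> m"
      unfolding P_small_def by (subst nn_integral_indicator) auto
    finally show "(\<integral>\<^sup>+\<omega>. ?I (S m \<omega> + X 0 \<omega>0) \<partial>M) \<le> P_small \<theta> m" .
  qed auto
  also have "(\<integral>\<^sup>+\<omega>0. ennreal (X 0 \<omega>0 ^ p) * P_small \<theta> m \<partial>M) = (\<integral>\<^sup>+\<omega>0. ennreal (X 0 \<omega>0 ^ p) \<partial>M) * P_small \<theta> m"
    by (rule nn_integral_multc) simp
  finally show ?thesis by (simp add: add_left_mono)
qed

text \<open>The smallness \<open>e\<close> of the jump moments is left free: a fixed small
  \<open>e\<close> yields the limit, and \<open>e\<close> of order \<open>1 / sqrt n\<close> yields
  the rate. The constant depends neither on \<open>n\<close> nor on \<open>e\<close>.\<close>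

lemma ET_le:
  assumes "integrable M (\<lambda>\<omega>. X 0 \<omega> ^ p)"
  obtains C where "C \<ge> 0" "\<And>n e. n \<ge> 1 \<Longrightarrow> n \<ge> p \<Longrightarrow> 0 \<le> e \<Longrightarrow> e \<le> 1 \<Longrightarrow>
    (\<And>j. j \<in> {2..p} \<Longrightarrow> of_nat n * jump_moment (real n * a / 2) j \<le> ennreal e) \<Longrightarrow>
    ET p n \<le> ennreal ((b / a) ^ p + C * (e + 1 / sqrt (real n)))"
proof -
  \<comment> \<open>This is \<open>n * b / \<theta>\<close>; its power times the limit
    \<open>1 / 2 ^ p\<close> of the negative moment is \<open>(b / a) ^ p\<close>.\<close>
  define \<beta> where "\<beta> = 2 * b / a"
  define C1 where "C1 = real p * (2 * (real p * a + sqrt b) / a)"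
  define C2 where "C2 = real p * (1 + \<beta> + 2 ^ p) ^ p"
  define \<kappa> where "\<kappa> = a\<^sup>2 / (8 * b)"
  define m where "m = expectation (\<lambda>\<omega>. X 0 \<omega> ^ p)"
  define C3 where "C3 = m * exp (3 * a\<^sup>2 / (8 * b)) * (2 / \<kappa>\<^sup>2)"
  have m0: "m \<ge> 0" unfolding m_def using pos by (intro integral_nonneg_AE AE_I2) (simp add: less_imp_le)
  have \<beta>0: "\<beta> \<ge> 0" and \<kappa>0: "\<kappa> > 0" unfolding \<beta>_def \<kappa>_def using a_pos b_pos by auto
  have C0: "C1 \<ge> 0" "C2 \<ge> 0" "C3 \<ge> 0"
    unfolding C1_def C2_def C3_def using a_pos b_pos m0 \<beta>0 by auto
  have m: "(\<integral>\<^sup>+\<omega>. ennreal (X 0 \<omega> ^ p) \<partial>M) = ennreal m"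
    unfolding m_def using assms pos by (intro nn_integral_eq_integral) (auto simp: less_imp_le)
  show ?thesis
  proof (rule that)
    show "\<beta> ^ p * C1 + C2 + C3 \<ge> 0" using C0 \<beta>0 by auto
    fix n :: nat and e :: real
    assume n: "n \<ge> 1" "n \<ge> p" and e: "0 \<le> e" "e \<le> 1"
      and J: "\<And>j. j \<in> {2..p} \<Longrightarrow> of_nat n * jump_moment (real n * a / 2) j \<le> ennreal e"
    let ?\<theta> = "real n * a / 2"
    have th: "?\<theta> > 0" using n a_pos by auto
    have sj: "small_jumps p \<beta> e n ?\<theta>"
      unfolding small_jumps_def using th e J n a_pos by (auto simp: \<beta>_def mult.commute)
    have "H ?\<theta> (n - p + p) p p \<le> ennreal (\<beta> ^ p * (1 / 2 ^ p + C1 / sqrt (real n)) + e * C2)"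
      unfolding C2_def
    proof (rule H_le_main_term[OF sj])
      show "H ?\<theta> (n - p) 0 p \<le> ennreal (1 / 2 ^ p + C1 / sqrt (real n))"
        unfolding C1_def by (rule H_0_le_limit) (use n in auto)
    qed (use n C0 in auto)
    then have h1: "H ?\<theta> n p p \<le> ennreal (\<beta> ^ p * (1 / 2 ^ p + C1 / sqrt (real n)) + e * C2)"
      using n by simp
    have n': "Suc (n - 1) = n" using n by simp
    have "of_nat n * ((\<integral>\<^sup>+\<omega>. ennreal (X 0 \<omega> ^ p) \<partial>M) * P_small ?\<theta> (n - 1)) \<le>
      of_nat n * (ennreal m * ennreal (exp (3 * a\<^sup>2 / (8 * b)) * exp (- real n * \<kappa>)))"
      unfolding m using P_small_le[of "n - 1"] n' unfolding \<kappa>_def by (intro mult_left_mono) auto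
    also have "\<dots> = ennreal (real n * (m * (exp (3 * a\<^sup>2 / (8 * b)) * exp (- real n * \<kappa>))))"
      using m0 by (simp add: ennreal_of_nat_eq_real_of_nat flip: ennreal_mult)
    also have "\<dots> \<le> ennreal (C3 / sqrt (real n))"
    proof (intro ennreal_leI)
      let ?y = "real n * \<kappa>"
      have y: "?y > 0" using n \<kappa>0 by auto
      \<comment> \<open>A crude quadratic bound already turns \<open>n\<close> times the exponential
        into order \<open>1 / n\<close>.\<close>
      have "exp (- z) \<le> 2 / z\<^sup>2" if "z > 0" for z :: real
        using exp_lower_Taylor_quadratic[of z] that by (simp add: exp_minus field_simps)
      from this[OF y] have "exp (- ?y) \<le> 2 / ?y\<^sup>2" .
      then have "real n * exp (- ?y) \<le> real n * (2 / ?y\<^sup>2)" by (intro mult_left_mono) auto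
      also have "\<dots> = 2 / \<kappa>\<^sup>2 / real n" using n by (simp add: power2_eq_square)
      also have "\<dots> \<le> 2 / \<kappa>\<^sup>2 / sqrt (real n)"
      proof (intro divide_left_mono)
        have "real n \<le> (real n)\<^sup>2" using n by (simp add: power2_eq_square)
        then show "sqrt (real n) \<le> real n" by (simp add: real_le_lsqrt)
      qed (use n in auto)
      finally have "m * exp (3 * a\<^sup>2 / (8 * b)) * (real n * exp (- ?y)) \<le>
          m * exp (3 * a\<^sup>2 / (8 * b)) * (2 / \<kappa>\<^sup>2 / sqrt (real n))"
        using m0 by (intro mult_left_mono) auto
      then show "real n * (m * (exp (3 * a\<^sup>2 / (8 * b)) * exp (- real n * \<kappa>))) \<le> C3 / sqrt (real n)"
        unfolding C3_def by (simp add: mult_ac)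
    qed
    finally have h2: "of_nat n * ((\<integral>\<^sup>+\<omega>. ennreal (X 0 \<omega> ^ p) \<partial>M) * P_small ?\<theta> (n - 1)) \<le>
      ennreal (C3 / sqrt (real n))" .
    have "ET p n \<le> ennreal (\<beta> ^ p * (1 / 2 ^ p + C1 / sqrt (real n)) + e * C2) + ennreal (C3 / sqrt (real n))"
      using ET_le_H[OF th, of p "n - 1"] h1 h2 unfolding n' by (meson add_mono order_trans)
    also have "\<dots> = ennreal (\<beta> ^ p * (1 / 2 ^ p + C1 / sqrt (real n)) + e * C2 + C3 / sqrt (real n))"
      using C0 \<beta>0 e by (subst ennreal_plus) auto
    also have "\<dots> \<le> ennreal ((b / a) ^ p + (\<beta> ^ p * C1 + C2 + C3) * (e + 1 / sqrt (real n)))"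
    proof (intro ennreal_leI)
      have "\<beta> ^ p * (1 / 2 ^ p) = (b / a) ^ p"
        unfolding \<beta>_def by (simp flip: power_mult_distrib add: power_one_over[symmetric])
      moreover have "0 \<le> e * (\<beta> ^ p * C1) + e * C3 + C2 / sqrt (real n)" using C0 \<beta>0 e by auto
      ultimately show "\<beta> ^ p * (1 / 2 ^ p + C1 / sqrt (real n)) + e * C2 + C3 / sqrt (real n) \<le>
         (b / a) ^ p + (\<beta> ^ p * C1 + C2 + C3) * (e + 1 / sqrt (real n))"
        by (simp add: algebra_simps add_divide_distrib)
    qed
    finally show "ET p n \<le> ennreal ((b / a) ^ p + (\<beta> ^ p * C1 + C2 + C3) * (e + 1 / sqrt (real n)))" .
  qed
qed

end

section \<open>Lower bound\<close>

text \<open>The tangent at \<open>t\<close> of the convex function \<open>s ^ (-p)\<close>. With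
  \<open>y = t / s\<close>, Bernoulli bounds \<open>y ^ p\<close> from below, and
  \<open>y + 1 / y \<ge> 2\<close> replaces \<open>y - 1\<close> by \<open>1 - 1 / y\<close>, which
  is linear in \<open>s\<close>.\<close>

lemma one_div_power_ge_tangent:
  fixes s t :: real
  assumes "s > 0" "t > 0"
  shows "1 / t ^ p * (1 + real p * (1 - s / t)) \<le> 1 / s ^ p"
proof -
  define y where "y = t / s"
  have y: "y > 0" unfolding y_def using assms by auto
  have "0 \<le> (y - 1)\<^sup>2 / y" using y by simp
  also have "(y - 1)\<^sup>2 / y = y + 1 / y - 2" using y by (simp add: power2_eq_square field_simps)
  finally have "1 - 1 / y \<le> y - 1" by simp
  then have "1 + real p * (1 - 1 / y) \<le> 1 + real p * (y - 1)" by (simp add: mult_left_mono)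
  also have "\<dots> \<le> (1 + (y - 1)) ^ p" using y by (intro Bernoulli_inequality) auto
  finally have "1 / t ^ p * (1 + real p * (1 - 1 / y)) \<le> 1 / t ^ p * y ^ p"
    using assms by (intro mult_left_mono) auto
  then show ?thesis unfolding y_def using assms by (simp add: power_divide)
qed

text \<open>This allows the main term and the single large jump to be kept side by side in the lower
  bound.\<close>

lemma add_power_le_power_add:
  fixes x y :: real
  assumes "x \<ge> 0" "y \<ge> 0" "q \<ge> 1"
  shows "x ^ q + y ^ q \<le> (x + y) ^ q"
  using assms(3)
proof (induction q rule: dec_induct)
  case (step q)
  have "x ^ Suc q + y ^ Suc q \<le> (x + y) * (x ^ q + y ^ q)"
    using assms by (simp add: algebra_simps)
  also have "\<dots> \<le> (x + y) * (x + y) ^ q" using assms step by (intro mult_left_mono) auto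
  finally show ?case by simp
qed simp

lemma nn_integral_ennreal_cmult:
  assumes "f \<in> borel_measurable M" "c \<ge> 0"
  shows "(\<integral>\<^sup>+x. ennreal (c * f x) \<partial>M) = ennreal c * (\<integral>\<^sup>+x. ennreal (f x) \<partial>M)"
  using assms by (simp add: ennreal_mult' nn_integral_cmult)

section \<open>Shifted moments and their iteration\<close>

context iid_positive begin

definition trunc_moment :: "real \<Rightarrow> real" where
  "trunc_moment K = expectation (\<lambda>\<omega>. (X 0 \<omega>)\<^sup>2 * indicator {..K} (X 0 \<omega>))"

lemma integrable_trunc_moment: "integrable M (\<lambda>\<omega>. (X 0 \<omega>)\<^sup>2 * indicator {..K} (X 0 \<omega>))"
  by (rule Bochner_Integration.integrable_bound[OF sq]) (auto simp: indicator_def)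

lemma nn_integral_trunc_moment: "(\<integral>\<^sup>+\<omega>. ennreal ((X 0 \<omega>)\<^sup>2 * indicator {..K} (X 0 \<omega>)) \<partial>M) = ennreal (trunc_moment K)"
  unfolding trunc_moment_def by (rule nn_integral_eq_integral[OF integrable_trunc_moment]) auto

lemma trunc_moment_nonneg: "trunc_moment K \<ge> 0"
  unfolding trunc_moment_def by (intro integral_nonneg_AE) auto

text \<open>The shift \<open>u\<close> stands for the summands already split off from the
  denominator: a truncated one is charged with its bound \<open>K\<close>, a large jump with its own
  value.\<close>

definition L :: "nat \<Rightarrow> nat \<Rightarrow> nat \<Rightarrow> real \<Rightarrow> ennreal" where
  "L p m q u = (\<integral>\<^sup>+\<omega>. ennreal (Q m \<omega> ^ q / (S m \<omega> + u) ^ p) \<partial>M)"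

text \<open>Jensen's inequality through the tangent at the mean of \<open>S m + u\<close>, whose
  expectation is the value at the mean. This form also covers an infinite left-over moment; the
  tangent can be negative, so its positive part is integrated.\<close>

lemma L_0_ge:
  assumes "u \<ge> 0" "real m * a + u > 0"
  shows "ennreal (1 / (real m * a + u) ^ p) \<le> L p m 0 u"
proof -
  let ?t = "real m * a + u"
  let ?g = "\<lambda>\<omega>. 1 / ?t ^ p * (1 + real p * (1 - (S m \<omega> + u) / ?t))"
  have S: "integrable M (S m)" "expectation (S m) = real m * a"
    unfolding S_def[abs_def] using moments_X by auto
  have g: "integrable M ?g" using S by simp
  have t: "- (real m * a / ?t) - u / ?t = - 1"
  proof -
    have "real m * a / ?t + u / ?t = 1" using assms(2) by (simp flip: add_divide_distrib)
    then show ?thesis by linarith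
  qed
  have "expectation ?g = 1 / ?t ^ p"
    using S t by (simp add: prob_space add_divide_distrib)
  moreover have "expectation ?g \<le> expectation (\<lambda>\<omega>. max 0 (?g \<omega>))"
    using g by (intro integral_mono) auto
  ultimately have "ennreal (1 / ?t ^ p) \<le> ennreal (expectation (\<lambda>\<omega>. max 0 (?g \<omega>)))"
    by (metis ennreal_leI)
  also have "\<dots> = (\<integral>\<^sup>+\<omega>. ennreal (max 0 (?g \<omega>)) \<partial>M)"
    using g by (subst nn_integral_eq_integral) auto
  also have "\<dots> \<le> L p m 0 u"
    unfolding L_def
  proof (intro nn_integral_mono ennreal_leI)
    fix \<omega> assume \<omega>: "\<omega> \<in> space M"
    have s: "S m \<omega> + u > 0"
    proof (cases "m = 0")
      case True then show ?thesis using assms by (simp add: S_def)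
    next
      case False then show ?thesis using S_pos[OF \<omega>, of m] assms by auto
    qed
    have "?g \<omega> \<le> 1 / (S m \<omega> + u) ^ p" by (rule one_div_power_ge_tangent) (use s assms in auto)
    then show "max 0 (?g \<omega>) \<le> Q m \<omega> ^ 0 / (S m \<omega> + u) ^ p" using s by simp
  qed
  finally show ?thesis .
qed

lemma L_Suc_eq:
  assumes "u \<ge> 0"
  shows "L p (Suc m) (Suc q) u = of_nat (Suc m) * (\<integral>\<^sup>+\<omega>0. \<integral>\<^sup>+\<omega>. ennreal ((X 0 \<omega>0)\<^sup>2 *
     ((Q m \<omega> + (X 0 \<omega>0)\<^sup>2) ^ q / (S m \<omega> + X 0 \<omega>0 + u) ^ p)) \<partial>M \<partial>M)"
proof -
  have "L p (Suc m) (Suc q) u = (\<integral>\<^sup>+\<omega>. ennreal (\<Sum>i<Suc m. (X i \<omega>)\<^sup>2) *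
     ennreal (Q (Suc m) \<omega> ^ q / (S (Suc m) \<omega> + u) ^ p) \<partial>M)"
    unfolding L_def
  proof (intro nn_integral_cong)
    fix \<omega> assume \<omega>: "\<omega> \<in> space M"
    show "ennreal (Q (Suc m) \<omega> ^ Suc q / (S (Suc m) \<omega> + u) ^ p) =
      ennreal (\<Sum>i<Suc m. (X i \<omega>)\<^sup>2) * ennreal (Q (Suc m) \<omega> ^ q / (S (Suc m) \<omega> + u) ^ p)"
      unfolding Q_def[of "Suc m" \<omega>, symmetric] using assms Q_nonneg S_nonneg[OF \<omega>]
      by (subst ennreal_mult[symmetric]) auto
  qed
  also have "\<dots> = of_nat (Suc m) * (\<integral>\<^sup>+\<omega>0. ennreal ((X 0 \<omega>0)\<^sup>2) *
      (\<integral>\<^sup>+\<omega>. ennreal ((Q m \<omega> + (X 0 \<omega>0)\<^sup>2) ^ q / (S m \<omega> + X 0 \<omega>0 + u) ^ p) \<partial>M) \<partial>M)"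
    by (rule nn_integral_pick_summand_QS) (simp_all add: split_beta')
  also have "\<dots> = of_nat (Suc m) * (\<integral>\<^sup>+\<omega>0. \<integral>\<^sup>+\<omega>. ennreal ((X 0 \<omega>0)\<^sup>2 *
     ((Q m \<omega> + (X 0 \<omega>0)\<^sup>2) ^ q / (S m \<omega> + X 0 \<omega>0 + u) ^ p)) \<partial>M \<partial>M)"
    by (intro arg_cong2[where f="(*)"] refl nn_integral_cong nn_integral_ennreal_cmult[symmetric]) auto
  finally show ?thesis .
qed

text \<open>Putting \<open>K\<close> in place of \<open>x\<close> in the denominator removes the
  dependence on the picked summand, so that the double integral factorises.\<close>

lemma truncated_summand_le:
  fixes x K u Q S :: real
  assumes "x > 0" "K > 0" "u \<ge> 0" "Q \<ge> 0" "S \<ge> 0"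
  shows "x\<^sup>2 * indicator {..K} x * (Q ^ q / (S + (u + K)) ^ p) \<le> x\<^sup>2 * (Q ^ q / (S + x + u) ^ p)"
proof (cases "x \<le> K")
  case True
  then have "Q ^ q / (S + (u + K)) ^ p \<le> Q ^ q / (S + x + u) ^ p"
    using assms by (intro divide_left_mono power_mono mult_pos_pos zero_less_power) auto
  from mult_left_mono[OF this zero_le_power2[of x]] True show ?thesis by simp
qed (use assms in auto)

lemma nn_integral_truncated_mult:
  "(\<integral>\<^sup>+\<omega>0. \<integral>\<^sup>+\<omega>. ennreal ((X 0 \<omega>0)\<^sup>2 * indicator {..K} (X 0 \<omega>0) * (Q m \<omega> ^ q / (S m \<omega> + u) ^ p)) \<partial>M \<partial>M) =
    ennreal (trunc_moment K) * L p m q u"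
proof -
  have "(\<integral>\<^sup>+\<omega>0. \<integral>\<^sup>+\<omega>. ennreal ((X 0 \<omega>0)\<^sup>2 * indicator {..K} (X 0 \<omega>0) * (Q m \<omega> ^ q / (S m \<omega> + u) ^ p)) \<partial>M \<partial>M) =
    (\<integral>\<^sup>+\<omega>0. ennreal ((X 0 \<omega>0)\<^sup>2 * indicator {..K} (X 0 \<omega>0)) * L p m q u \<partial>M)"
    unfolding L_def by (intro nn_integral_cong nn_integral_ennreal_cmult) auto
  also have "\<dots> = ennreal (trunc_moment K) * L p m q u"
    by (simp add: nn_integral_multc nn_integral_trunc_moment)
  finally show ?thesis .
qed

lemma L_Suc_ge:
  assumes "u \<ge> 0" "K > 0"
  shows "of_nat (Suc m) * (ennreal (trunc_moment K) * L p m q (u + K)) \<le> L p (Suc m) (Suc q) u"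
  unfolding L_Suc_eq[OF assms(1)] nn_integral_truncated_mult[symmetric]
proof (intro mult_left_mono nn_integral_mono ennreal_leI)
  fix \<omega>0 \<omega> assume \<omega>: "\<omega>0 \<in> space M" "\<omega> \<in> space M"
  let ?x = "X 0 \<omega>0"
  have "?x\<^sup>2 * indicator {..K} ?x * (Q m \<omega> ^ q / (S m \<omega> + (u + K)) ^ p) \<le>
     ?x\<^sup>2 * (Q m \<omega> ^ q / (S m \<omega> + ?x + u) ^ p)"
    using assms \<omega> by (intro truncated_summand_le pos Q_nonneg S_nonneg) auto
  also have "\<dots> \<le> ?x\<^sup>2 * ((Q m \<omega> + ?x\<^sup>2) ^ q / (S m \<omega> + ?x + u) ^ p)"
    using assms \<omega> pos[OF \<omega>(1), of 0] S_nonneg[OF \<omega>(2), of m] Q_nonneg[of m \<omega>]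
    by (intro mult_left_mono divide_right_mono power_mono) auto
  finally show "?x\<^sup>2 * indicator {..K} ?x * (Q m \<omega> ^ q / (S m \<omega> + (u + K)) ^ p) \<le>
     ?x\<^sup>2 * ((Q m \<omega> + ?x\<^sup>2) ^ q / (S m \<omega> + ?x + u) ^ p)" .
qed simp

text \<open>Each use of \<open>L_Suc_ge\<close> gives a factor at least
  \<open>m * trunc_moment K\<close> and raises the shift by \<open>K\<close>; after \<open>q\<close>
  uses Jensen's inequality handles the remaining \<open>m\<close> variables.\<close>

lemma L_ge:
  assumes "u \<ge> 0" "K > 0" "m > 0"
  shows "ennreal ((real m * trunc_moment K) ^ q / (real m * a + u + real q * K) ^ p) \<le> L p (m + q) q u"
  using assms(1)
proof (induction q arbitrary: u)
  case 0
  then show ?case using L_0_ge[of u m p] assms a_pos by (auto simp: add_pos_nonneg)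
next
  case (Suc q)
  let ?D = "(real m * a + u + real (Suc q) * K) ^ p"
  have D: "?D \<ge> 0" using a_pos Suc.prems assms by auto
  have "ennreal ((real m * trunc_moment K) ^ Suc q / ?D) = of_nat m * (ennreal (trunc_moment K) * ennreal ((real m * trunc_moment K) ^ q / ?D))"
    using D trunc_moment_nonneg[of K]
    by (simp add: ennreal_of_nat_eq_real_of_nat mult_ac flip: ennreal_mult)
  also have "\<dots> \<le> of_nat (Suc (m + q)) * (ennreal (trunc_moment K) * L p (m + q) q (u + K))"
  proof (intro mult_mono)
    have "ennreal ((real m * trunc_moment K) ^ q / (real m * a + (u + K) + real q * K) ^ p) \<le> L p (m + q) q (u + K)"
      using Suc.prems assms by (intro Suc.IH) auto
    also have "real m * a + (u + K) + real q * K = real m * a + u + real (Suc q) * K"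
      by (simp add: algebra_simps)
    finally show "ennreal ((real m * trunc_moment K) ^ q / ?D) \<le> L p (m + q) q (u + K)" .
    show "(of_nat m :: ennreal) \<le> of_nat (Suc (m + q))"
      by (simp only: of_nat_le_iff)
  qed auto
  also have "\<dots> \<le> L p (Suc (m + q)) (Suc q) u"
    by (rule L_Suc_ge) (use Suc.prems assms in auto)
  finally show ?case by simp
qed

section \<open>Contribution of one large summand\<close>

text \<open>Given a summand \<open>x \<ge> n\<close>, Jensen replaces the other variables by their
  mean \<open>m * a\<close>, which is at most \<open>x * a\<close>. Hence
  \<open>x\<^sup>2 / (m * a + x)\<close> is at least \<open>x / (1 + a)\<close>.\<close>

lemma single_jump_ge:
  assumes "m + 1 = n"
  shows "ennreal ((real n / (1 + a)) ^ p * measure M {\<omega>\<in>space M. X 0 \<omega> \<ge> real n}) \<le>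
    (\<integral>\<^sup>+\<omega>0. \<integral>\<^sup>+\<omega>. ennreal ((X 0 \<omega>0) ^ (2 * p) / (S m \<omega> + X 0 \<omega>0) ^ p) \<partial>M \<partial>M)"
proof -
  let ?A = "{\<omega>\<in>space M. X 0 \<omega> \<ge> real n}"
  have "ennreal ((real n / (1 + a)) ^ p * measure M ?A) = ennreal ((real n / (1 + a)) ^ p) * emeasure M ?A"
    using a_pos by (simp add: emeasure_eq_measure ennreal_mult)
  also have "\<dots> = (\<integral>\<^sup>+\<omega>0. ennreal ((real n / (1 + a)) ^ p) * indicator ?A \<omega>0 \<partial>M)"
    by (subst nn_integral_cmult_indicator) auto
  also have "\<dots> \<le> (\<integral>\<^sup>+\<omega>0. \<integral>\<^sup>+\<omega>. ennreal ((X 0 \<omega>0) ^ (2 * p) / (S m \<omega> + X 0 \<omega>0) ^ p) \<partial>M \<partial>M)"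
  proof (intro nn_integral_mono)
    fix \<omega>0 assume \<omega>0: "\<omega>0 \<in> space M"
    let ?x = "X 0 \<omega>0"
    have x: "?x > 0" using pos \<omega>0 by auto
    show "ennreal ((real n / (1 + a)) ^ p) * indicator ?A \<omega>0 \<le>
       (\<integral>\<^sup>+\<omega>. ennreal (?x ^ (2 * p) / (S m \<omega> + ?x) ^ p) \<partial>M)"
    proof (cases "?x \<ge> real n")
      case True
      have ma: "0 \<le> real m * a" using a_pos by auto
      have "real m * a \<le> ?x * a" using True assms a_pos by (intro mult_right_mono) auto
      then have "?x * (real m * a + ?x) \<le> ?x * (?x * (1 + a))"
        using x by (intro mult_left_mono) (auto simp: algebra_simps)
      then have "?x / (1 + a) \<le> ?x\<^sup>2 / (real m * a + ?x)"
        using x a_pos ma by (simp add: divide_simps power2_eq_square add_nonneg_pos mult_ac)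
      moreover have "real n / (1 + a) \<le> ?x / (1 + a)" using True a_pos by (intro divide_right_mono) auto
      ultimately have "real n / (1 + a) \<le> ?x\<^sup>2 / (real m * a + ?x)" by linarith
      then have "(real n / (1 + a)) ^ p \<le> (?x\<^sup>2 / (real m * a + ?x)) ^ p"
        using a_pos by (intro power_mono) auto
      also have "\<dots> = ?x ^ (2 * p) * (1 / (real m * a + ?x) ^ p)"
        by (simp add: power_divide power_mult)
      finally have "ennreal ((real n / (1 + a)) ^ p) \<le> ennreal (?x ^ (2 * p)) * ennreal (1 / (real m * a + ?x) ^ p)"
        using x ma by (simp flip: ennreal_mult add: ennreal_leI)
      also have "\<dots> \<le> ennreal (?x ^ (2 * p)) * L p m 0 ?x"
        using x ma by (intro mult_left_mono L_0_ge) auto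
      also have "\<dots> = (\<integral>\<^sup>+\<omega>. ennreal (?x ^ (2 * p) / (S m \<omega> + ?x) ^ p) \<partial>M)"
        unfolding L_def using x by (subst nn_integral_cmult[symmetric]) (auto simp flip: ennreal_mult')
      finally show ?thesis by (simp add: indicator_def)
    qed auto
  qed
  finally show ?thesis .
qed

text \<open>One summand \<open>x\<close> is picked from the first factor of \<open>Q ^ p\<close>.
  With \<open>q = p - 1 \<ge> 1\<close>, superadditivity splits \<open>(Q' + x^2) ^ q\<close> into
  \<open>x ^ (2 * q)\<close>, kept for large \<open>x\<close>, and \<open>Q' ^ q\<close>, kept with
  \<open>x\<close> truncated. The two parts are added, not compared, so the jump term is an excess
  over the main term.\<close>

lemma ET_ge:
  assumes "p \<ge> 2" "m > 0" "K > 0" "n = m + p"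
  shows "ennreal (real n * ((real n / (1 + a)) ^ p * measure M {\<omega>\<in>space M. X 0 \<omega> \<ge> real n}) +
    (real m * trunc_moment K / (real m * a + real p * K)) ^ p) \<le> ET p n"
proof -
  obtain q where q: "p = Suc q" "q \<ge> 1" using assms by (cases p) auto
  let ?m = "m + q"
  have n: "n = Suc ?m" using q assms by simp
  let ?Pn = "(real n / (1 + a)) ^ p * measure M {\<omega>\<in>space M. X 0 \<omega> \<ge> real n}"
  let ?D = "real m * a + real p * K"
  have D: "?D \<ge> 0" and b0: "trunc_moment K \<ge> 0" using a_pos assms trunc_moment_nonneg by auto
  have "ennreal (real n * ?Pn + (real m * trunc_moment K / ?D) ^ p) = ennreal (real n * ?Pn) + ennreal ((real m * trunc_moment K / ?D) ^ p)"
    using a_pos D b0 by (intro ennreal_plus) auto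
  also have "\<dots> \<le> of_nat n * (ennreal ?Pn + ennreal (trunc_moment K) * L p ?m q K)"
  proof -
    have "ennreal ((real m * trunc_moment K / ?D) ^ p) = of_nat m * (ennreal (trunc_moment K) * ennreal ((real m * trunc_moment K) ^ q / ?D ^ p))"
      using D b0 q
      by (simp add: ennreal_of_nat_eq_real_of_nat power_divide mult_ac flip: ennreal_mult)
    also have "\<dots> \<le> of_nat n * (ennreal (trunc_moment K) * L p ?m q K)"
    proof (intro mult_mono)
      \<comment> \<open>The picked summand has already used one shift \<open>K\<close>; the other
        \<open>q\<close> bring the total to \<open>real p * K\<close>.\<close>
      show "ennreal ((real m * trunc_moment K) ^ q / ?D ^ p) \<le> L p ?m q K"
        using L_ge[of K K m q p] assms q by (simp add: algebra_simps)
    qed (use assms in auto)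
    finally have "ennreal ((real m * trunc_moment K / ?D) ^ p) \<le> of_nat n * (ennreal (trunc_moment K) * L p ?m q K)" .
    moreover have "ennreal (real n * ?Pn) = of_nat n * ennreal ?Pn"
      using a_pos by (simp add: ennreal_of_nat_eq_real_of_nat ennreal_mult')
    ultimately show ?thesis by (simp add: distrib_left add_left_mono)
  qed
  also have "\<dots> \<le> of_nat n * ((\<integral>\<^sup>+\<omega>0. \<integral>\<^sup>+\<omega>. ennreal ((X 0 \<omega>0) ^ (2 * p) / (S ?m \<omega> + X 0 \<omega>0) ^ p) \<partial>M \<partial>M) +
     (\<integral>\<^sup>+\<omega>0. \<integral>\<^sup>+\<omega>. ennreal ((X 0 \<omega>0)\<^sup>2 * indicator {..K} (X 0 \<omega>0) * (Q ?m \<omega> ^ q / (S ?m \<omega> + K) ^ p)) \<partial>M \<partial>M))"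
    unfolding nn_integral_truncated_mult using n by (intro mult_left_mono add_right_mono single_jump_ge) auto
  also have "\<dots> = of_nat n * (\<integral>\<^sup>+\<omega>0. \<integral>\<^sup>+\<omega>. ennreal ((X 0 \<omega>0) ^ (2 * p) / (S ?m \<omega> + X 0 \<omega>0) ^ p) +
     ennreal ((X 0 \<omega>0)\<^sup>2 * indicator {..K} (X 0 \<omega>0) * (Q ?m \<omega> ^ q / (S ?m \<omega> + K) ^ p)) \<partial>M \<partial>M)"
    by (simp add: nn_integral_add)
  also have "\<dots> \<le> L p n p 0"
    unfolding n q(1) L_Suc_eq[OF order.refl]
  proof (intro mult_left_mono nn_integral_mono, unfold q(1)[symmetric])
    fix \<omega>0 \<omega> assume \<omega>: "\<omega>0 \<in> space M" "\<omega> \<in> space M"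
    let ?x = "X 0 \<omega>0" let ?S = "S ?m \<omega>" let ?Q = "Q ?m \<omega>"
    have x: "?x > 0" "?S \<ge> 0" "?Q \<ge> 0" using \<omega> pos S_nonneg Q_nonneg by auto
    have "?x ^ (2 * p) / (?S + ?x) ^ p + ?x\<^sup>2 * indicator {..K} ?x * (?Q ^ q / (?S + K) ^ p) \<le>
      ?x\<^sup>2 * ((?x\<^sup>2) ^ q / (?S + ?x) ^ p) + ?x\<^sup>2 * (?Q ^ q / (?S + ?x) ^ p)"
      using truncated_summand_le[of ?x K 0 ?Q ?S q p] x assms
      by (intro add_mono) (auto simp: q power_mult[symmetric] simp flip: power_add)
    also have "\<dots> = ?x\<^sup>2 * ((?Q ^ q + (?x\<^sup>2) ^ q) / (?S + ?x) ^ p)"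
      by (simp add: distrib_left add_divide_distrib)
    also have "\<dots> \<le> ?x\<^sup>2 * ((?Q + ?x\<^sup>2) ^ q / (?S + ?x) ^ p)"
      using x q by (intro mult_left_mono divide_right_mono add_power_le_power_add) auto
    finally show "ennreal (?x ^ (2 * p) / (?S + ?x) ^ p) + ennreal (?x\<^sup>2 * indicator {..K} ?x * (?Q ^ q / (?S + K) ^ p)) \<le>
      ennreal (?x\<^sup>2 * ((?Q + ?x\<^sup>2) ^ q / (?S + ?x + 0) ^ p))"
      using x assms by (subst ennreal_plus[symmetric]) (auto intro!: ennreal_leI simp del: ennreal_plus)
  qed simp
  also have "L p n p 0 = ET p n"
    unfolding L_def ET_def T_stat_eq by (simp add: power_divide)
  finally show ?thesis .
qed

end

section \<open>Tail conditions and moments\<close>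

text \<open>On \<open>Y \<ge> u\<close> the power is written as \<open>u powr s\<close> plus the
  integral of its derivative from \<open>u\<close> to \<open>Y\<close>, and Fubini turns the inner
  condition into a tail probability. Starting at \<open>u\<close> restricts attention to the range
  where tail bounds are available.\<close>

lemma (in prob_space) nn_integral_powr_layer_cake:
  fixes Y :: "'a \<Rightarrow> real" and s u :: real
  assumes [measurable]: "Y \<in> borel_measurable M" and s: "s > 0" and u: "u > 0"
  shows "(\<integral>\<^sup>+\<omega>. ennreal (Y \<omega> powr s) * indicator {u..} (Y \<omega>) \<partial>M) =
    ennreal (u powr s) * emeasure M {\<omega>\<in>space M. Y \<omega> \<ge> u} +
    (\<integral>\<^sup>+t. ennreal (s * t powr (s - 1)) * indicator {u..} t * emeasure M {\<omega>\<in>space M. Y \<omega> \<ge> t} \<partial>lborel)"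
proof -
  interpret pair_sigma_finite M lborel ..
  let ?f = "\<lambda>t. s * t powr (s - 1)"
  have "ennreal (Y \<omega> powr s) * indicator {u..} (Y \<omega>) = ennreal (u powr s) * indicator {u..} (Y \<omega>) +
      (\<integral>\<^sup>+t. ennreal (?f t) * (indicator {u..} t * indicator {..Y \<omega>} t) \<partial>lborel)" for \<omega>
  proof (cases "Y \<omega> \<ge> u")
    case True
    have "(\<integral>\<^sup>+t. ennreal (?f t) * (indicator {u..} t * indicator {..Y \<omega>} t) \<partial>lborel) =
      (\<integral>\<^sup>+t. ennreal (?f t) * indicator {u..Y \<omega>} t \<partial>lborel)"
      by (intro nn_integral_cong) (auto simp: indicator_def)
    also have "\<dots> = ennreal (Y \<omega> powr s - u powr s)"
    proof (rule nn_integral_FTC_Icc)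
      fix t assume "t \<in> {u..Y \<omega>}"
      then have t: "t > 0" using u by auto
      show "DERIV (\<lambda>t. t powr s) t :> ?f t"
        using t by (auto intro!: derivative_eq_intros)
      show "0 \<le> ?f t" using s by simp
    qed (use True in auto)
    finally have "(\<integral>\<^sup>+t. ennreal (?f t) * (indicator {u..} t * indicator {..Y \<omega>} t) \<partial>lborel) =
      ennreal (Y \<omega> powr s - u powr s)" .
    moreover have "u powr s \<le> Y \<omega> powr s" using True u s by (intro powr_mono2) auto
    ultimately show ?thesis using True by (simp flip: ennreal_plus)
  next
    case False
    then have "(\<integral>\<^sup>+t. ennreal (?f t) * (indicator {u..} t * indicator {..Y \<omega>} t) \<partial>lborel) = (\<integral>\<^sup>+(t::real). 0 \<partial>lborel)"
      by (intro nn_integral_cong) (auto simp: indicator_def)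
    with False show ?thesis by simp
  qed
  \<comment> \<open>The condition \<open>t \<le> Y \<omega>\<close> is phrased as membership of a
    pair in a fixed closed set, for joint measurability.\<close>
  then have "(\<integral>\<^sup>+\<omega>. ennreal (Y \<omega> powr s) * indicator {u..} (Y \<omega>) \<partial>M) =
    (\<integral>\<^sup>+\<omega>. ennreal (u powr s) * indicator {u..} (Y \<omega>) +
      (\<integral>\<^sup>+t. ennreal (?f t) * (indicator {u..} t * indicator {x. fst x \<le> snd x} (t, Y \<omega>)) \<partial>lborel) \<partial>M)"
    by (intro nn_integral_cong) (simp add: indicator_def)
  also have "\<dots> = (\<integral>\<^sup>+\<omega>. ennreal (u powr s) * indicator {u..} (Y \<omega>) \<partial>M) +
      (\<integral>\<^sup>+\<omega>. (\<integral>\<^sup>+t. ennreal (?f t) * (indicator {u..} t * indicator {x. fst x \<le> snd x} (t, Y \<omega>)) \<partial>lborel) \<partial>M)"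
    by (rule nn_integral_add) measurable
  also have "(\<integral>\<^sup>+\<omega>. (\<integral>\<^sup>+t. ennreal (?f t) * (indicator {u..} t * indicator {x. fst x \<le> snd x} (t, Y \<omega>)) \<partial>lborel) \<partial>M) =
    (\<integral>\<^sup>+t. (\<integral>\<^sup>+\<omega>. ennreal (?f t) * (indicator {u..} t * indicator {x. fst x \<le> snd x} (t, Y \<omega>)) \<partial>M) \<partial>lborel)"
    by (rule Fubini'[symmetric]) measurable
  also have "\<dots> = (\<integral>\<^sup>+t. ennreal (?f t) * indicator {u..} t * emeasure M {\<omega>\<in>space M. Y \<omega> \<ge> t} \<partial>lborel)"
  proof (intro nn_integral_cong)
    fix t
    have "(\<integral>\<^sup>+\<omega>. ennreal (?f t) * (indicator {u..} t * indicator {x. fst x \<le> snd x} (t, Y \<omega>)) \<partial>M) =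
      (\<integral>\<^sup>+\<omega>. (ennreal (?f t) * indicator {u..} t) * indicator {\<omega>\<in>space M. Y \<omega> \<ge> t} \<omega> \<partial>M)"
      by (intro nn_integral_cong) (auto simp: indicator_def)
    also have "\<dots> = ennreal (?f t) * indicator {u..} t * emeasure M {\<omega>\<in>space M. Y \<omega> \<ge> t}"
      by (rule nn_integral_cmult_indicator) measurable
    finally show "(\<integral>\<^sup>+\<omega>. ennreal (?f t) * (indicator {u..} t * indicator {x. fst x \<le> snd x} (t, Y \<omega>)) \<partial>M) =
      ennreal (?f t) * indicator {u..} t * emeasure M {\<omega>\<in>space M. Y \<omega> \<ge> t}" .
  qed
  also have "(\<integral>\<^sup>+\<omega>. ennreal (u powr s) * indicator {u..} (Y \<omega>) \<partial>M) =
    (\<integral>\<^sup>+\<omega>. ennreal (u powr s) * indicator {\<omega>\<in>space M. Y \<omega> \<ge> u} \<omega> \<partial>M)"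
    by (intro nn_integral_cong) (auto simp: indicator_def)
  also have "\<dots> = ennreal (u powr s) * emeasure M {\<omega>\<in>space M. Y \<omega> \<ge> u}"
    by (rule nn_integral_cmult_indicator) measurable
  finally show ?thesis .
qed

text \<open>For \<open>s < \<alpha>\<close> the integrand \<open>t powr (s - \<alpha> - 1)\<close>
  is integrable at infinity and the lower end \<open>u\<close> governs; the boundary term adds 1 to
  \<open>s / (\<alpha> - s)\<close>.\<close>

lemma (in prob_space) nn_integral_powr_tail_le:
  fixes Y :: "'a \<Rightarrow> real" and s u \<epsilon> \<alpha> :: real
  assumes [measurable]: "Y \<in> borel_measurable M" and s: "0 < s" "s < \<alpha>" and u: "u > 0" and \<epsilon>: "\<epsilon> \<ge> 0"
    and tail: "\<And>t. t \<ge> u \<Longrightarrow> measure M {\<omega>\<in>space M. Y \<omega> \<ge> t} \<le> \<epsilon> * t powr (- \<alpha>)"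
  shows "(\<integral>\<^sup>+\<omega>. ennreal (Y \<omega> powr s) * indicator {u..} (Y \<omega>) \<partial>M) \<le>
    ennreal (\<epsilon> * (\<alpha> / (\<alpha> - s)) * u powr (s - \<alpha>))"
proof -
  let ?F = "\<lambda>t. - (\<epsilon> * (s / (\<alpha> - s)) * t powr (s - \<alpha>))"
  have tail': "emeasure M {\<omega>\<in>space M. Y \<omega> \<ge> t} \<le> ennreal (\<epsilon> * t powr (- \<alpha>))" if "t \<ge> u" for t
    using tail[OF that] by (simp add: emeasure_eq_measure ennreal_leI)
  have "(\<integral>\<^sup>+t. ennreal (s * t powr (s - 1)) * indicator {u..} t * emeasure M {\<omega>\<in>space M. Y \<omega> \<ge> t} \<partial>lborel) \<le>
    (\<integral>\<^sup>+t. ennreal (\<epsilon> * s * t powr (s - \<alpha> - 1)) * indicator {u..} t \<partial>lborel)"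
  proof (intro nn_integral_mono)
    fix t
    show "ennreal (s * t powr (s - 1)) * indicator {u..} t * emeasure M {\<omega>\<in>space M. Y \<omega> \<ge> t} \<le>
      ennreal (\<epsilon> * s * t powr (s - \<alpha> - 1)) * indicator {u..} t"
    proof (cases "t \<ge> u")
      case True
      have "ennreal (s * t powr (s - 1)) * emeasure M {\<omega>\<in>space M. Y \<omega> \<ge> t} \<le>
        ennreal (s * t powr (s - 1)) * ennreal (\<epsilon> * t powr (- \<alpha>))"
        by (intro mult_left_mono tail' True) auto
      also have "\<dots> = ennreal (\<epsilon> * s * (t powr (s - 1) * t powr (- \<alpha>)))"
        using s \<epsilon> by (simp add: mult_ac flip: ennreal_mult)
      also have "t powr (s - 1) * t powr (- \<alpha>) = t powr (s - \<alpha> - 1)"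
        by (subst powr_add[symmetric]) (simp add: algebra_simps)
      finally show ?thesis using True by simp
    qed auto
  qed
  also have "\<dots> = ennreal (0 - ?F u)"
  proof (rule nn_integral_FTC_atLeast)
    fix t assume "u \<le> t"
    then have t: "t > 0" using u by auto
    show "DERIV ?F t :> \<epsilon> * s * t powr (s - \<alpha> - 1)"
      using t s by (auto intro!: derivative_eq_intros simp: divide_simps) (simp add: algebra_simps)
    show "0 \<le> \<epsilon> * s * t powr (s - \<alpha> - 1)" using s \<epsilon> by simp
  next
    have "((\<lambda>t. t powr (s - \<alpha>)) \<longlongrightarrow> 0) at_top" using s by (intro tendsto_neg_powr filterlim_ident) auto
    then have "(?F \<longlongrightarrow> - (\<epsilon> * (s / (\<alpha> - s)) * 0)) at_top" by (intro tendsto_intros)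
    then show "(?F \<longlongrightarrow> 0) at_top" by simp
  qed measurable
  finally have 1: "(\<integral>\<^sup>+t. ennreal (s * t powr (s - 1)) * indicator {u..} t * emeasure M {\<omega>\<in>space M. Y \<omega> \<ge> t} \<partial>lborel) \<le>
     ennreal (\<epsilon> * (s / (\<alpha> - s)) * u powr (s - \<alpha>))" by simp
  have 2: "ennreal (u powr s) * emeasure M {\<omega>\<in>space M. Y \<omega> \<ge> u} \<le> ennreal (\<epsilon> * u powr (s - \<alpha>))"
  proof -
    have "ennreal (u powr s) * emeasure M {\<omega>\<in>space M. Y \<omega> \<ge> u} \<le> ennreal (u powr s) * ennreal (\<epsilon> * u powr (- \<alpha>))"
      by (intro mult_left_mono tail') auto
    also have "\<dots> = ennreal (\<epsilon> * (u powr s * u powr (- \<alpha>)))" using \<epsilon> by (simp add: mult_ac flip: ennreal_mult)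
    also have "u powr s * u powr (- \<alpha>) = u powr (s - \<alpha>)" by (simp flip: powr_add)
    finally show ?thesis .
  qed
  have "(\<integral>\<^sup>+\<omega>. ennreal (Y \<omega> powr s) * indicator {u..} (Y \<omega>) \<partial>M) \<le>
    ennreal (\<epsilon> * u powr (s - \<alpha>)) + ennreal (\<epsilon> * (s / (\<alpha> - s)) * u powr (s - \<alpha>))"
    by (subst nn_integral_powr_layer_cake) (use s u 1 2 in \<open>auto intro!: add_mono\<close>)
  also have "\<dots> = ennreal (\<epsilon> * u powr (s - \<alpha>) + \<epsilon> * (s / (\<alpha> - s)) * u powr (s - \<alpha>))"
    using \<epsilon> s by (subst ennreal_plus) auto
  also have "\<epsilon> * u powr (s - \<alpha>) + \<epsilon> * (s / (\<alpha> - s)) * u powr (s - \<alpha>) = \<epsilon> * (1 + s / (\<alpha> - s)) * u powr (s - \<alpha>)"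
    by (simp add: algebra_simps)
  also have "1 + s / (\<alpha> - s) = \<alpha> / (\<alpha> - s)" using s by (simp add: field_simps)
  finally show ?thesis .
qed

text \<open>For \<open>s > \<alpha>\<close> the upper end \<open>v\<close> of the truncation governs
  instead. The factor 2 collects the values below \<open>u\<close> and the boundary term at
  \<open>u\<close>, where the probability is bounded by 1.\<close>

lemma (in prob_space) nn_integral_powr_min_le:
  fixes Y :: "'a \<Rightarrow> real" and s u \<epsilon> \<alpha> :: real
  assumes [measurable]: "Y \<in> borel_measurable M" and s: "0 < \<alpha>" "\<alpha> < s" and u: "u > 0" "u \<le> v" and \<epsilon>: "\<epsilon> \<ge> 0"
    and pos: "\<And>\<omega>. \<omega> \<in> space M \<Longrightarrow> Y \<omega> \<ge> 0"
    and tail: "\<And>t. t \<ge> u \<Longrightarrow> measure M {\<omega>\<in>space M. Y \<omega> \<ge> t} \<le> \<epsilon> * t powr (- \<alpha>)"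
  shows "(\<integral>\<^sup>+\<omega>. ennreal (min (Y \<omega>) v powr s) \<partial>M) \<le>
    ennreal (2 * u powr s + \<epsilon> * (s / (s - \<alpha>)) * v powr (s - \<alpha>))"
proof -
  let ?Y = "\<lambda>\<omega>. min (Y \<omega>) v"
  let ?F = "\<lambda>t. \<epsilon> * (s / (s - \<alpha>)) * t powr (s - \<alpha>)"
  have "(\<integral>\<^sup>+t. ennreal (s * t powr (s - 1)) * indicator {u..} t * emeasure M {\<omega>\<in>space M. ?Y \<omega> \<ge> t} \<partial>lborel) \<le>
    (\<integral>\<^sup>+t. ennreal (\<epsilon> * s * t powr (s - \<alpha> - 1)) * indicator {u..v} t \<partial>lborel)"
  proof (intro nn_integral_mono)
    fix t
    show "ennreal (s * t powr (s - 1)) * indicator {u..} t * emeasure M {\<omega>\<in>space M. ?Y \<omega> \<ge> t} \<le>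
      ennreal (\<epsilon> * s * t powr (s - \<alpha> - 1)) * indicator {u..v} t"
    proof (cases "t \<ge> u \<and> t \<le> v")
      case True
      have "emeasure M {\<omega>\<in>space M. ?Y \<omega> \<ge> t} \<le> emeasure M {\<omega>\<in>space M. Y \<omega> \<ge> t}"
        by (intro emeasure_mono) auto
      also have "\<dots> \<le> ennreal (\<epsilon> * t powr (- \<alpha>))"
        using tail[of t] True by (simp add: emeasure_eq_measure ennreal_leI)
      finally have "ennreal (s * t powr (s - 1)) * emeasure M {\<omega>\<in>space M. ?Y \<omega> \<ge> t} \<le>
        ennreal (s * t powr (s - 1)) * ennreal (\<epsilon> * t powr (- \<alpha>))"
        by (intro mult_left_mono) auto
      also have "\<dots> = ennreal (\<epsilon> * s * (t powr (s - 1) * t powr (- \<alpha>)))"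
        using s \<epsilon> by (simp add: mult_ac flip: ennreal_mult)
      also have "t powr (s - 1) * t powr (- \<alpha>) = t powr (s - \<alpha> - 1)"
        by (subst powr_add[symmetric]) (simp add: algebra_simps)
      finally show ?thesis using True by simp
    next
      case False
      \<comment> \<open>For \<open>t > v\<close> the event is empty because the variable is capped
        at \<open>v\<close>.\<close>
      then have "t < u \<or> {\<omega>\<in>space M. ?Y \<omega> \<ge> t} = {}" by auto
      then show ?thesis
        by (elim disjE) (simp, simp only: emeasure_empty mult_zero_right zero_le)
    qed
  qed
  also have "\<dots> = ennreal (?F v - ?F u)"
  proof (rule nn_integral_FTC_Icc)
    fix t assume "t \<in> {u..v}"
    then have t: "t > 0" using u by auto
    show "DERIV ?F t :> \<epsilon> * s * t powr (s - \<alpha> - 1)"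
      using t s by (auto intro!: derivative_eq_intros simp: divide_simps)
    show "0 \<le> \<epsilon> * s * t powr (s - \<alpha> - 1)" using s \<epsilon> by simp
  qed (use u in auto)
  also have "\<dots> \<le> ennreal (?F v)" using s \<epsilon> by (intro ennreal_leI) auto
  finally have 1: "(\<integral>\<^sup>+t. ennreal (s * t powr (s - 1)) * indicator {u..} t * emeasure M {\<omega>\<in>space M. ?Y \<omega> \<ge> t} \<partial>lborel) \<le>
     ennreal (?F v)" .
  have 2: "ennreal (u powr s) * emeasure M {\<omega>\<in>space M. ?Y \<omega> \<ge> u} \<le> ennreal (u powr s) * 1"
    by (intro mult_left_mono) (auto simp: emeasure_eq_measure)
  have "(\<integral>\<^sup>+\<omega>. ennreal (?Y \<omega> powr s) \<partial>M) \<le>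
    (\<integral>\<^sup>+\<omega>. ennreal (u powr s) + ennreal (?Y \<omega> powr s) * indicator {u..} (?Y \<omega>) \<partial>M)"
  proof (intro nn_integral_mono)
    fix \<omega> assume \<omega>: "\<omega> \<in> space M"
    have "?Y \<omega> powr s \<le> u powr s" if "?Y \<omega> < u"
      using that pos[OF \<omega>] u s by (intro powr_mono2) auto
    moreover have "ennreal (y powr s) \<le> ennreal (u powr s) + ennreal (y powr s) * indicator {u..} y"
      if "y < u \<Longrightarrow> y powr s \<le> u powr s" for y :: real
      using that by (cases "y < u") (auto simp: ennreal_leI add_increasing)
    ultimately show "ennreal (?Y \<omega> powr s) \<le> ennreal (u powr s) + ennreal (?Y \<omega> powr s) * indicator {u..} (?Y \<omega>)"
      by blast
  qed
  also have "\<dots> = ennreal (u powr s) + (\<integral>\<^sup>+\<omega>. ennreal (?Y \<omega> powr s) * indicator {u..} (?Y \<omega>) \<partial>M)"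
    by (subst nn_integral_add) (auto simp: emeasure_space_1)
  also have "\<dots> \<le> ennreal (u powr s) + (ennreal (u powr s) + ennreal (?F v))"
    by (subst nn_integral_powr_layer_cake) (use s u 1 2 in \<open>auto intro!: add_mono add_left_mono simp del: min.bounded_iff\<close>)
  also have "\<dots> = ennreal (2 * u powr s + ?F v)"
    using s \<epsilon> by (simp flip: ennreal_plus)
  finally show ?thesis .
qed

section \<open>Jump moments under a power tail\<close>

context iid_positive begin

text \<open>The integrand is \<open>x ^ (2 * j) / \<theta> ^ j\<close> below \<open>\<theta>\<close>
  and \<open>x ^ j\<close> above. As \<open>\<alpha>\<close> lies strictly between \<open>j\<close>
  and \<open>2 * j\<close>, both pieces are governed by values near \<open>\<theta>\<close> and have
  the common order \<open>\<theta> powr (j - \<alpha>)\<close>.\<close>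

lemma jump_moment_le:
  assumes j: "real j < \<alpha>" "\<alpha> < 2 * real j" and u: "u > 0" "u \<le> \<theta>" and \<epsilon>: "\<epsilon> \<ge> 0"
    and tail: "\<And>t. t \<ge> u \<Longrightarrow> measure M {\<omega>\<in>space M. X 0 \<omega> \<ge> t} \<le> \<epsilon> * t powr (- \<alpha>)"
  shows "jump_moment \<theta> j \<le> ennreal (2 * u ^ (2 * j) / \<theta> ^ j +
    \<epsilon> * (2 * real j / (2 * real j - \<alpha>) + \<alpha> / (\<alpha> - real j)) * \<theta> powr (real j - \<alpha>))"
proof -
  have th: "\<theta> > 0" and j0: "j > 0" using u j by (auto intro: gr0I)
  let ?A = "\<epsilon> * (2 * real j / (2 * real j - \<alpha>)) * \<theta> powr (2 * real j - \<alpha>)"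
  let ?B = "\<epsilon> * (\<alpha> / (\<alpha> - real j)) * \<theta> powr (real j - \<alpha>)"
  have "jump_moment \<theta> j \<le> (\<integral>\<^sup>+\<omega>. ennreal (1 / \<theta> ^ j) * ennreal (min (X 0 \<omega>) \<theta> powr (2 * real j)) +
    ennreal (X 0 \<omega> powr real j) * indicator {\<theta>..} (X 0 \<omega>) \<partial>M)"
    unfolding jump_moment_def
  proof (intro nn_integral_mono)
    fix \<omega> assume \<omega>: "\<omega> \<in> space M"
    let ?x = "X 0 \<omega>"
    have x: "?x > 0" using pos \<omega> by auto
    show "ennreal ((?x\<^sup>2 / max ?x \<theta>) ^ j) \<le> ennreal (1 / \<theta> ^ j) * ennreal (min ?x \<theta> powr (2 * real j)) +
      ennreal (?x powr real j) * indicator {\<theta>..} ?x"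
    proof (cases "?x < \<theta>")
      case True
      have "min ?x \<theta> powr (2 * real j) = ?x powr real (2 * j)" using True by simp
      also have "\<dots> = ?x ^ (2 * j)" using x by (rule powr_realpow)
      finally have "1 / \<theta> ^ j * min ?x \<theta> powr (2 * real j) = (?x\<^sup>2 / max ?x \<theta>) ^ j"
        using True th by (simp add: power_mult power_divide)
      then have "ennreal (1 / \<theta> ^ j) * ennreal (min ?x \<theta> powr (2 * real j)) = ennreal ((?x\<^sup>2 / max ?x \<theta>) ^ j)"
        using th by (simp only: ennreal_mult[symmetric] powr_ge_zero zero_le_divide_1_iff zero_le_power less_imp_le)
      then show ?thesis by (simp add: add_increasing2)
    next
      case False
      then have "?x\<^sup>2 / max ?x \<theta> = ?x" using x by (simp add: max_def power2_eq_square)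
      then have "ennreal ((?x\<^sup>2 / max ?x \<theta>) ^ j) = ennreal (?x powr real j) * indicator {\<theta>..} ?x"
        using False x by (simp add: powr_realpow)
      then show ?thesis by (simp add: add_increasing)
    qed
  qed
  also have "\<dots> = ennreal (1 / \<theta> ^ j) * (\<integral>\<^sup>+\<omega>. ennreal (min (X 0 \<omega>) \<theta> powr (2 * real j)) \<partial>M) +
    (\<integral>\<^sup>+\<omega>. ennreal (X 0 \<omega> powr real j) * indicator {\<theta>..} (X 0 \<omega>) \<partial>M)"
    by (subst nn_integral_add) (auto simp: nn_integral_cmult)
  also have "\<dots> \<le> ennreal (1 / \<theta> ^ j) * ennreal (2 * u powr (2 * real j) + ?A) + ennreal ?B"
  proof (intro add_mono mult_left_mono)
    show "(\<integral>\<^sup>+\<omega>. ennreal (min (X 0 \<omega>) \<theta> powr (2 * real j)) \<partial>M) \<le> ennreal (2 * u powr (2 * real j) + ?A)"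
      by (rule nn_integral_powr_min_le) (use j j0 u \<epsilon> tail pos in \<open>auto simp: less_imp_le\<close>)
    show "(\<integral>\<^sup>+\<omega>. ennreal (X 0 \<omega> powr real j) * indicator {\<theta>..} (X 0 \<omega>) \<partial>M) \<le> ennreal ?B"
      by (rule nn_integral_powr_tail_le) (use j j0 u \<epsilon> tail in auto)
  qed simp
  also have "\<dots> = ennreal (1 / \<theta> ^ j * (2 * u powr (2 * real j) + ?A) + ?B)"
    using th j \<epsilon> by (subst ennreal_mult[symmetric], simp, simp) (subst ennreal_plus[symmetric], auto)
  also have "1 / \<theta> ^ j * (2 * u powr (2 * real j) + ?A) + ?B = 2 * u ^ (2 * j) / \<theta> ^ j +
    \<epsilon> * (2 * real j / (2 * real j - \<alpha>) + \<alpha> / (\<alpha> - real j)) * \<theta> powr (real j - \<alpha>)"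
  proof -
    have "u powr (2 * real j) = u ^ (2 * j)" using powr_realpow[OF u(1), of "2 * j"] by simp
    moreover have "\<theta> powr (2 * real j - \<alpha>) = \<theta> ^ j * \<theta> powr (real j - \<alpha>)"
      using th by (simp add: powr_realpow[symmetric] powr_add[symmetric])
    ultimately show ?thesis using th by (simp add: distrib_left distrib_right)
  qed
  finally show ?thesis .
qed

text \<open>The tail exponent is written as \<open>j + \<sigma>\<close>, so that the order
  \<open>n powr (1 - \<sigma>)\<close> is the same for every \<open>j\<close>; a tail of exponent
  \<open>p + \<sigma>\<close> may be weakened to it for \<open>j \<le> p\<close>. The bounds
  \<open>\<sigma> < 2 \<le> j\<close> give \<open>j + \<sigma> < 2 * j\<close>. The relevant values
  are \<open>\<sigma> = 1\<close> and \<open>\<sigma> = 3/2\<close>.\<close>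

lemma n_jump_moment_le:
  assumes j: "j \<ge> 2" and \<sigma>: "0 < \<sigma>" "\<sigma> < 2" and u: "u > 0" "u \<le> real n * a / 2" and \<epsilon>: "\<epsilon> \<ge> 0"
    and tail: "\<And>t. t \<ge> u \<Longrightarrow> measure M {\<omega>\<in>space M. X 0 \<omega> \<ge> t} \<le> \<epsilon> * t powr (- (real j + \<sigma>))"
  shows "of_nat n * jump_moment (real n * a / 2) j \<le> ennreal (2 * u ^ (2 * j) * (2 / a) ^ j / real n +
    \<epsilon> * ((2 * real j / (real j - \<sigma>) + (real j + \<sigma>) / \<sigma>) * (a / 2) powr (- \<sigma>)) * real n powr (1 - \<sigma>))"
proof -
  let ?\<theta> = "real n * a / 2"
  have n: "n > 0" using u a_pos by (auto intro: gr0I)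
  have "of_nat n * jump_moment ?\<theta> j \<le> of_nat n * ennreal (2 * u ^ (2 * j) / ?\<theta> ^ j +
    \<epsilon> * (2 * real j / (2 * real j - (real j + \<sigma>)) + (real j + \<sigma>) / ((real j + \<sigma>) - real j)) * ?\<theta> powr (real j - (real j + \<sigma>)))"
    by (intro mult_left_mono jump_moment_le) (use assms in auto)
  also have "\<dots> = ennreal (real n * (2 * u ^ (2 * j) / ?\<theta> ^ j) +
    \<epsilon> * (2 * real j / (real j - \<sigma>) + (real j + \<sigma>) / \<sigma>) * (real n * ?\<theta> powr (- \<sigma>)))"
    using j \<sigma> u \<epsilon>
    by (simp add: ennreal_of_nat_eq_real_of_nat distrib_left mult_ac flip: ennreal_mult')
  also have "\<dots> \<le> ennreal (2 * u ^ (2 * j) * (2 / a) ^ j / real n +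
    \<epsilon> * ((2 * real j / (real j - \<sigma>) + (real j + \<sigma>) / \<sigma>) * (a / 2) powr (- \<sigma>)) * real n powr (1 - \<sigma>))"
  proof (intro ennreal_leI add_mono)
    have "real n * ?\<theta> powr (- \<sigma>) = real n powr 1 * (real n powr (- \<sigma>) * (a / 2) powr (- \<sigma>))"
      using n a_pos powr_mult[of "real n" "a / 2" "- \<sigma>"] by simp
    also have "\<dots> = real n powr (1 - \<sigma>) * (a / 2) powr (- \<sigma>)"
      by (simp only: mult.assoc[symmetric] powr_add[symmetric]) simp
    finally show "\<epsilon> * (2 * real j / (real j - \<sigma>) + (real j + \<sigma>) / \<sigma>) * (real n * ?\<theta> powr (- \<sigma>)) \<le>
      \<epsilon> * ((2 * real j / (real j - \<sigma>) + (real j + \<sigma>) / \<sigma>) * (a / 2) powr (- \<sigma>)) * real n powr (1 - \<sigma>)"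
      by (simp add: mult_ac)
    have "real n * (2 * u ^ (2 * j) / ?\<theta> ^ j) = 2 * u ^ (2 * j) * (2 / a) ^ j * (real n / real n ^ j)"
      by (simp add: power_divide power_mult_distrib mult_ac)
    also have "real n / real n ^ j \<le> 1 / real n"
    proof -
      have "real n ^ 2 \<le> real n ^ j" using n j by (intro power_increasing) auto
      then have "real n / real n ^ j \<le> real n / real n ^ 2" using n by (intro divide_left_mono) auto
      then show ?thesis using n by (simp add: power2_eq_square)
    qed
    finally show "real n * (2 * u ^ (2 * j) / ?\<theta> ^ j) \<le> 2 * u ^ (2 * j) * (2 / a) ^ j / real n"
      using u a_pos by (simp add: mult_left_mono)
  qed
  finally show ?thesis .
qed

lemma integrable_powr_of_tail:
  assumes q: "0 < q" "q < \<alpha>" and \<epsilon>: "\<epsilon> \<ge> 0" and u: "u > 0"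
    and tail: "\<And>t. t \<ge> u \<Longrightarrow> measure M {\<omega>\<in>space M. X 0 \<omega> \<ge> t} \<le> \<epsilon> * t powr (- \<alpha>)"
  shows "integrable M (\<lambda>\<omega>. X 0 \<omega> powr q)"
proof (rule integrableI_nonneg)
  have "(\<integral>\<^sup>+\<omega>. ennreal (X 0 \<omega> powr q) \<partial>M) \<le>
     (\<integral>\<^sup>+\<omega>. ennreal (u powr q) + ennreal (X 0 \<omega> powr q) * indicator {u..} (X 0 \<omega>) \<partial>M)"
  proof (intro nn_integral_mono)
    fix \<omega> assume \<omega>: "\<omega> \<in> space M"
    have "X 0 \<omega> powr q \<le> u powr q" if "X 0 \<omega> < u"
      using that pos[OF \<omega>, of 0] u q by (intro powr_mono2) auto
    then show "ennreal (X 0 \<omega> powr q) \<le> ennreal (u powr q) + ennreal (X 0 \<omega> powr q) * indicator {u..} (X 0 \<omega>)"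
      by (cases "X 0 \<omega> < u") (auto simp: ennreal_leI add_increasing)
  qed
  also have "\<dots> = ennreal (u powr q) + (\<integral>\<^sup>+\<omega>. ennreal (X 0 \<omega> powr q) * indicator {u..} (X 0 \<omega>) \<partial>M)"
    by (subst nn_integral_add) (auto simp: emeasure_space_1)
  also have "\<dots> \<le> ennreal (u powr q) + ennreal (\<epsilon> * (\<alpha> / (\<alpha> - q)) * u powr (q - \<alpha>))"
    by (intro add_left_mono nn_integral_powr_tail_le) (use assms in auto)
  also have "\<dots> < \<infinity>" by simp
  finally show "(\<integral>\<^sup>+\<omega>. ennreal (X 0 \<omega> powr q) \<partial>M) < \<infinity>" .
qed auto

end

section \<open>Convergence of the moments of the statistic\<close>

context iid_positive begin

abbreviation tail :: "real \<Rightarrow> real" where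
  "tail x \<equiv> measure M {\<omega>\<in>space M. X 0 \<omega> \<ge> x}"

lemma tail_antimono: "x \<le> y \<Longrightarrow> tail y \<le> tail x"
  by (intro finite_measure_mono) auto

lemma integrable_power_of_tail:
  assumes "tail \<in> O[at_top](\<lambda>x. x powr (- (real k + \<sigma>)))" "\<sigma> > 0" "k > 0"
  shows "integrable M (\<lambda>\<omega>. X 0 \<omega> ^ k)"
proof -
  obtain C where C: "C > 0" "\<forall>\<^sub>F x in at_top. norm (tail x) \<le> C * norm (x powr (- (real k + \<sigma>)))"
    using assms(1) by (rule landau_o.bigE)
  then obtain u0 where u0: "\<And>x. x \<ge> u0 \<Longrightarrow> norm (tail x) \<le> C * norm (x powr (- (real k + \<sigma>)))"
    by (auto simp: eventually_at_top_linorder)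
  have "integrable M (\<lambda>\<omega>. X 0 \<omega> powr real k)"
    by (rule integrable_powr_of_tail[where u="max 1 u0" and \<epsilon>=C and \<alpha>="real k + \<sigma>"]) (use assms C u0 in auto)
  also have "?this \<longleftrightarrow> integrable M (\<lambda>\<omega>. X 0 \<omega> ^ k)"
    using pos by (intro Bochner_Integration.integrable_cong) (auto simp: powr_realpow)
  finally show ?thesis .
qed

lemma ET_finite:
  assumes "integrable M (\<lambda>\<omega>. X 0 \<omega> ^ p)" "n \<ge> 1"
  shows "ET p n < \<infinity>"
proof -
  obtain m where n: "n = Suc m" using assms by (cases n) auto
  have i: "integrable M (\<lambda>\<omega>. \<bar>X 0 \<omega>\<bar> ^ p)"
    using integrable_abs[OF assms(1)] by (simp add: power_abs)
  have "ET p n \<le> (\<integral>\<^sup>+\<omega>. ennreal (\<Sum>i<Suc m. \<bar>X i \<omega>\<bar> ^ p) * 1 \<partial>M)"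
    unfolding ET_def T_stat_eq
  proof (intro nn_integral_mono)
    fix \<omega> assume \<omega>: "\<omega> \<in> space M"
    have "ennreal ((Q n \<omega> / S n \<omega>) ^ p) \<le> ennreal (\<Sum>i<n. (X i \<omega>) ^ p)"
      using \<omega> assms by (intro ennreal_leI T_power_le_sum) auto
    also have "(\<Sum>i<n. (X i \<omega>) ^ p) = (\<Sum>i<Suc m. \<bar>X i \<omega>\<bar> ^ p)"
      unfolding n using \<omega> pos by (intro sum.cong) (auto simp: less_imp_le)
    finally show "ennreal ((Q n \<omega> / S n \<omega>) ^ p) \<le> ennreal (\<Sum>i<Suc m. \<bar>X i \<omega>\<bar> ^ p) * 1" by simp
  qed
  also have "\<dots> = of_nat (Suc m) * (\<integral>\<^sup>+\<omega>0. ennreal (\<bar>X 0 \<omega>0\<bar> ^ p) * (\<integral>\<^sup>+\<omega>. 1 \<partial>M) \<partial>M)"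
    by (rule nn_integral_pick_summand_QS[where f="\<lambda>_ _. 1"]) auto
  also have "\<dots> = of_nat (Suc m) * (\<integral>\<^sup>+\<omega>0. ennreal (\<bar>X 0 \<omega>0\<bar> ^ p) \<partial>M)"
    by (simp add: emeasure_space_1)
  also have "(\<integral>\<^sup>+\<omega>0. ennreal (\<bar>X 0 \<omega>0\<bar> ^ p) \<partial>M) = ennreal (expectation (\<lambda>\<omega>. \<bar>X 0 \<omega>\<bar> ^ p))"
    using i by (intro nn_integral_eq_integral) auto
  also have "of_nat (Suc m) * \<dots> < \<infinity>"
    by (simp add: ennreal_mult_less_top ennreal_of_nat_eq_real_of_nat del: of_nat_Suc)
  finally show ?thesis .
qed

section \<open>The main lower bound and its limit\<close>

text \<open>The jump-free term of \<open>ET_ge\<close> for \<open>m = n - p\<close> and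
  \<open>K = sqrt (real n)\<close>.\<close>

definition lower_bound :: "nat \<Rightarrow> nat \<Rightarrow> real" where
  "lower_bound p n = (real (n - p) * trunc_moment (sqrt (real n)) / (real (n - p) * a + real p * sqrt (real n))) ^ p"

lemma ET_ge_lower_bound:
  assumes "p \<ge> 2" "n > p"
  shows "ennreal (real n * ((real n / (1 + a)) ^ p * tail (real n)) + lower_bound p n) \<le> ET p n"
  using ET_ge[of p "n - p" "sqrt (real n)" n] assms unfolding lower_bound_def by simp

lemma lower_bound_nonneg: "lower_bound p n \<ge> 0"
  unfolding lower_bound_def using trunc_moment_nonneg a_pos by auto

lemma lower_bound_le_ET:
  assumes "p \<ge> 2" "n > p"
  shows "ennreal (lower_bound p n) \<le> ET p n"
proof -
  have "ennreal (lower_bound p n) \<le> ennreal (real n * ((real n / (1 + a)) ^ p * tail (real n)) + lower_bound p n)"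
    using a_pos by (intro ennreal_leI) auto
  with ET_ge_lower_bound[OF assms] show ?thesis by (rule order_trans[rotated])
qed

lemma trunc_moment_tendsto: "((\<lambda>K. trunc_moment K) \<longlongrightarrow> b) at_top"
  unfolding trunc_moment_def b_def
proof (rule integral_dominated_convergence_at_top[where w="\<lambda>\<omega>. (X 0 \<omega>)\<^sup>2"])
  show "AE \<omega> in M. ((\<lambda>K. (X 0 \<omega>)\<^sup>2 * indicator {..K} (X 0 \<omega>)) \<longlongrightarrow> (X 0 \<omega>)\<^sup>2) at_top"
  proof (rule AE_I2, rule tendsto_eventually)
    fix \<omega>
    show "\<forall>\<^sub>F K in at_top. (X 0 \<omega>)\<^sup>2 * indicator {..K} (X 0 \<omega>) = (X 0 \<omega>)\<^sup>2"
      using eventually_ge_at_top[of "X 0 \<omega>"] by eventually_elim simp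
  qed
  show "\<forall>\<^sub>F K in at_top. AE \<omega> in M. norm ((X 0 \<omega>)\<^sup>2 * indicator {..K} (X 0 \<omega>)) \<le> (X 0 \<omega>)\<^sup>2"
    by (intro always_eventually allI AE_I2) (auto simp: indicator_def)
qed (use sq in auto)

lemma lower_bound_tendsto: "lower_bound p \<longlonglongrightarrow> (b / a) ^ p"
proof -
  have s: "filterlim (\<lambda>n. sqrt (real n)) at_top sequentially"
    by (intro filterlim_compose[OF sqrt_at_top] filterlim_real_sequentially)
  have trunc_moment: "(\<lambda>n. trunc_moment (sqrt (real n))) \<longlonglongrightarrow> b"
    by (rule filterlim_compose[OF trunc_moment_tendsto s])
  have "(\<lambda>n. real (n - p) / real n) \<longlonglongrightarrow> 1"
  proof -
    have "(\<lambda>n. (real n - real p) / real n) \<longlonglongrightarrow> 1" by real_asymp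
    moreover have "\<forall>\<^sub>F n in sequentially. (real n - real p) / real n = real (n - p) / real n"
      using eventually_ge_at_top[of p] by eventually_elim (simp add: of_nat_diff)
    ultimately show ?thesis using filterlim_cong[OF refl refl] by fast
  qed
  moreover have "(\<lambda>n. real p * (sqrt (real n) / real n)) \<longlonglongrightarrow> 0" by real_asymp
  ultimately have "(\<lambda>n. (real (n - p) / real n * trunc_moment (sqrt (real n)) /
     (real (n - p) / real n * a + real p * (sqrt (real n) / real n))) ^ p) \<longlonglongrightarrow> (1 * b / (1 * a + 0)) ^ p"
    using a_pos by (intro tendsto_intros trunc_moment) auto
  moreover have "\<forall>\<^sub>F n in sequentially. (real (n - p) / real n * trunc_moment (sqrt (real n)) /
     (real (n - p) / real n * a + real p * (sqrt (real n) / real n))) ^ p = lower_bound p n"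
    using eventually_gt_at_top[of p]
  proof eventually_elim
    case (elim n)
    have "real (n - p) / real n * trunc_moment (sqrt (real n)) = (real (n - p) * trunc_moment (sqrt (real n))) / real n"
      "real (n - p) / real n * a + real p * (sqrt (real n) / real n) =
        (real (n - p) * a + real p * sqrt (real n)) / real n"
      by (simp_all add: add_divide_distrib)
    then show ?case unfolding lower_bound_def using elim by simp
  qed
  ultimately show ?thesis using filterlim_cong[OF refl refl] by (force simp: tendsto_cong)
qed

section \<open>Equivalence of convergence and the tail condition\<close>

text \<open>The lower half is \<open>lower_bound_tendsto\<close>. For the upper half
  \<open>e\<close> is fixed first, depending only on \<open>y\<close>; the little-o tail then brings
  all jump moments below \<open>e\<close> for large \<open>n\<close>.\<close>

lemma ET_tendsto_of_tail:
  assumes p: "p \<ge> 2" and o: "tail \<in> o[at_top](\<lambda>x. x powr (- (real p + 1)))"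
  shows "ET p \<longlonglongrightarrow> ennreal ((b / a) ^ p)"
proof (rule order_tendstoI)
  fix y assume "y < ennreal ((b / a) ^ p)"
  moreover have "(\<lambda>n. ennreal (lower_bound p n)) \<longlonglongrightarrow> ennreal ((b / a) ^ p)"
    by (intro tendsto_ennrealI lower_bound_tendsto)
  ultimately have "\<forall>\<^sub>F n in sequentially. y < ennreal (lower_bound p n)" by (rule order_tendstoD(1)[rotated])
  with eventually_gt_at_top[of p] show "\<forall>\<^sub>F n in sequentially. y < ET p n"
    by eventually_elim (use lower_bound_le_ET[OF p] in \<open>auto intro: less_le_trans\<close>)
next
  fix y assume y: "ennreal ((b / a) ^ p) < y"
  have "integrable M (\<lambda>\<omega>. X 0 \<omega> ^ p)"
    by (rule integrable_power_of_tail[where \<sigma>=1]) (use p landau_o.small_imp_big[OF o] in auto)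
  from ET_le[OF this] obtain C where C: "C \<ge> 0" "\<And>n e. n \<ge> 1 \<Longrightarrow> n \<ge> p \<Longrightarrow> 0 \<le> e \<Longrightarrow> e \<le> 1 \<Longrightarrow>
    (\<And>j. j \<in> {2..p} \<Longrightarrow> of_nat n * jump_moment (real n * a / 2) j \<le> ennreal e) \<Longrightarrow>
    ET p n \<le> ennreal ((b / a) ^ p + C * (e + 1 / sqrt (real n)))" by blast
  have "((\<lambda>e. ennreal ((b / a) ^ p + C * (e + e))) \<longlongrightarrow> ennreal ((b / a) ^ p + C * (0 + 0))) (at_right 0)"
    by (intro tendsto_ennrealI tendsto_intros)
  then have "\<forall>\<^sub>F e in at_right 0. ennreal ((b / a) ^ p + C * (e + e)) < y"
    using y by (intro order_tendstoD(2)) auto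
  moreover have "\<forall>\<^sub>F e in at_right (0::real). e \<in> {0<..<1}" by (rule eventually_at_right_real) simp
  ultimately have "\<forall>\<^sub>F e in at_right 0. ennreal ((b / a) ^ p + C * (e + e)) < y \<and> e \<in> {0<..<1}"
    by eventually_elim auto
  then obtain e where e: "ennreal ((b / a) ^ p + C * (e + e)) < y" "e > 0" "e < 1"
    using eventually_happens'[of "at_right (0::real)"] by auto
  have "\<forall>\<^sub>F n in sequentially. of_nat n * jump_moment (real n * a / 2) j \<le> ennreal e" if j: "j \<in> {2..p}" for j
  proof -
    define B where "B = (2 * real j / (real j - 1) + (real j + 1) / 1) * (a / 2) powr (- 1)"
    have B: "B > 0" unfolding B_def using j a_pos by (intro mult_pos_pos add_pos_pos divide_pos_pos) auto
    \<comment> \<open>With \<open>\<sigma> = 1\<close> the tail part of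
      \<open>n_jump_moment_le\<close> is \<open>\<epsilon> * B = e / 2\<close>; the other half of
      \<open>e\<close> is for the term of order \<open>1 / n\<close>.\<close>
    define \<epsilon> where "\<epsilon> = e / (2 * B)"
    have \<epsilon>: "\<epsilon> > 0" unfolding \<epsilon>_def using e B by auto
    obtain u0 where u0: "\<And>x. x \<ge> u0 \<Longrightarrow> norm (tail x) \<le> \<epsilon> * norm (x powr (- (real p + 1)))"
      using landau_o.smallD[OF o \<epsilon>] by (auto simp: eventually_at_top_linorder)
    \<comment> \<open>The lower limit 1 makes \<open>t powr\<close> monotone in its exponent, so the
      tail bound can be weakened from \<open>p\<close> to \<open>j\<close>.\<close>
    define u where "u = max 1 u0"
    have u: "u > 0" unfolding u_def by auto
    have tl: "tail t \<le> \<epsilon> * t powr (- (real j + 1))" if "t \<ge> u" for t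
    proof -
      have "tail t \<le> \<epsilon> * t powr (- (real p + 1))" using u0[of t] that unfolding u_def by auto
      also have "\<dots> \<le> \<epsilon> * t powr (- (real j + 1))"
        using that \<epsilon> j unfolding u_def by (intro mult_left_mono powr_mono) auto
      finally show ?thesis .
    qed
    have "\<forall>\<^sub>F n in sequentially. 2 * u ^ (2 * j) * (2 / a) ^ j / real n < e / 2"
      using e by (intro order_tendstoD(2)[where y=0] real_tendsto_divide_at_top[OF tendsto_const] filterlim_real_sequentially) auto
    moreover have "\<forall>\<^sub>F n in sequentially. u * 2 / a \<le> real n"
      using filterlim_real_sequentially by (auto simp: filterlim_at_top)
    ultimately show ?thesis using eventually_gt_at_top[of 0]
    proof eventually_elim
      case (elim n)
      have "u \<le> real n * a / 2" using elim a_pos by (simp add: field_simps)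
      then have "of_nat n * jump_moment (real n * a / 2) j \<le> ennreal (2 * u ^ (2 * j) * (2 / a) ^ j / real n +
         \<epsilon> * B * real n powr (1 - 1))"
        unfolding B_def using j u \<epsilon> tl by (intro n_jump_moment_le) auto
      also have "\<dots> \<le> ennreal e"
        using elim e B unfolding \<epsilon>_def by (intro ennreal_leI) auto
      finally show ?case .
    qed
  qed
  then have "\<forall>\<^sub>F n in sequentially. \<forall>j\<in>{2..p}. of_nat n * jump_moment (real n * a / 2) j \<le> ennreal e"
    by (intro eventually_ball_finite) auto
  moreover have "\<forall>\<^sub>F n in sequentially. 1 / sqrt (real n) < e"
  proof (rule order_tendstoD(2))
    show "(\<lambda>n. 1 / sqrt (real n)) \<longlonglongrightarrow> 0" by real_asymp
  qed fact
  ultimately show "\<forall>\<^sub>F n in sequentially. ET p n < y" using eventually_ge_at_top[of "max 1 p"]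
  proof eventually_elim
    case (elim n)
    have "ET p n \<le> ennreal ((b / a) ^ p + C * (e + 1 / sqrt (real n)))"
      using elim e by (intro C(2)) auto
    also have "\<dots> \<le> ennreal ((b / a) ^ p + C * (e + e))"
      using elim C(1) by (intro ennreal_leI add_left_mono mult_left_mono) auto
    finally show ?case using e by (auto intro: le_less_trans)
  qed
qed

text \<open>A squeeze: \<open>ET\<close> and \<open>lower_bound\<close> have the same limit, and the
  jump term of \<open>ET_ge\<close> lies in the gap between them, so it tends to 0. Monotonicity of
  the tail passes from integers to real arguments.\<close>

lemma tail_of_ET_tendsto:
  assumes p: "p \<ge> 2" and lim: "ET p \<longlonglongrightarrow> ennreal ((b / a) ^ p)"
  shows "tail \<in> o[at_top](\<lambda>x. x powr (- (real p + 1)))"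
proof (rule landau_o.smallI)
  fix \<epsilon> :: real assume \<epsilon>: "\<epsilon> > 0"
  let ?c = "(b / a) ^ p"
  have c0: "?c \<ge> 0" using b_pos a_pos by auto
  \<comment> \<open>\<open>(1 + a) ^ p\<close> comes from the jump term and
    \<open>2 ^ (p + 1)\<close> from passing from \<open>x\<close> to its integer part; the 2 in
    \<open>\<delta>\<close> covers the two deviations from the limit.\<close>
  define K where "K = (1 + a) ^ p * 2 ^ (p + 1)"
  have K: "K > 0" unfolding K_def using a_pos by auto
  define \<delta> where "\<delta> = \<epsilon> / (2 * K)"
  have \<delta>: "\<delta> > 0" unfolding \<delta>_def using \<epsilon> K by auto
  have "\<forall>\<^sub>F n in sequentially. ET p n < ennreal (?c + \<delta>)"
    using c0 \<delta> by (intro order_tendstoD(2)[OF lim]) (simp add: ennreal_less_iff del: ennreal_plus)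
  moreover have "\<forall>\<^sub>F n in sequentially. lower_bound p n > ?c - \<delta>"
    using \<delta> by (intro order_tendstoD(1)[OF lower_bound_tendsto]) auto
  ultimately have "\<forall>\<^sub>F n in sequentially. tail (real n) \<le> 2 * \<delta> * (1 + a) ^ p / real n ^ (p + 1)"
    using eventually_gt_at_top[of p]
  proof eventually_elim
    case (elim n)
    let ?r = "real n * ((real n / (1 + a)) ^ p * tail (real n))"
    have r0: "0 \<le> ?r" using a_pos by auto
    have "ennreal (?r + lower_bound p n) < ennreal (?c + \<delta>)"
      using ET_ge_lower_bound[OF p, of n] elim by (auto intro: le_less_trans)
    then have "?r + lower_bound p n < ?c + \<delta>"
      using r0 lower_bound_nonneg[of p n] by (subst (asm) ennreal_less_iff) auto
    then have "?r < 2 * \<delta>" using elim by linarith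
    then have "real n ^ (p + 1) / (1 + a) ^ p * tail (real n) \<le> 2 * \<delta>"
      by (simp add: power_divide mult_ac)
    then show ?case using elim a_pos by (simp add: field_simps)
  qed
  then obtain N where N: "\<And>n. n \<ge> N \<Longrightarrow> tail (real n) \<le> 2 * \<delta> * (1 + a) ^ p / real n ^ (p + 1)"
    by (auto simp: eventually_sequentially)
  show "\<forall>\<^sub>F x in at_top. norm (tail x) \<le> \<epsilon> * norm (x powr (- (real p + 1)))"
    using eventually_ge_at_top[of "real N + 1"]
  proof eventually_elim
    case (elim x)
    define n where "n = nat \<lfloor>x\<rfloor>"
    have n: "real n \<le> x" "x < real n + 1" "n \<ge> N" "n \<ge> 1"
      unfolding n_def using elim by linarith+
    \<comment> \<open>\<open>n \<ge> 1\<close> gives \<open>x < n + 1 \<le> 2 * n\<close>.\<close>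
    then have x2: "(x / 2) ^ (p + 1) \<le> real n ^ (p + 1)" using elim by (intro power_mono) linarith+
    have "tail x \<le> tail (real n)" using n by (intro tail_antimono)
    also have "\<dots> \<le> 2 * \<delta> * (1 + a) ^ p / real n ^ (p + 1)" using N n by auto
    also have "\<dots> \<le> 2 * \<delta> * (1 + a) ^ p / (x / 2) ^ (p + 1)"
      using n elim \<delta> a_pos by (intro divide_left_mono[OF x2] mult_pos_pos zero_less_power) auto
    also have "\<dots> = \<epsilon> / x ^ (p + 1)"
      unfolding \<delta>_def K_def using a_pos by (simp add: power_divide)
    also have "x ^ (p + 1) = x powr (real p + 1)"
      using elim powr_realpow[of x "p + 1"] by (simp add: add.commute)
    finally show ?case unfolding powr_minus_divide using elim by simp
  qed
qed

section \<open>Rate of convergence\<close>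

text \<open>The upper half is \<open>ET_le\<close> with \<open>e = D' / sqrt n\<close>. In the lower
  half the error of \<open>lower_bound\<close> comes from truncating the second moment, controlled
  by E X^3, and from the term \<open>p * sqrt n\<close> in the denominator.\<close>

lemma ET_rate:
  assumes p: "p \<ge> 2" and O: "tail \<in> O[at_top](\<lambda>x. x powr (- (real p + 3 / 2)))"
  obtains C N where "C \<ge> 0" "\<And>n. n \<ge> N \<Longrightarrow> \<bar>enn2real (ET p n) - (b / a) ^ p\<bar> \<le> C / sqrt (real n)"
proof -
  let ?c = "b / a"
  have c: "?c > 0" using a_pos b_pos by auto
  have ip: "integrable M (\<lambda>\<omega>. X 0 \<omega> ^ p)"
    by (rule integrable_power_of_tail[OF O]) (use p in auto)
  from ET_le[OF ip] obtain C where C: "C \<ge> 0" "\<And>n e. n \<ge> 1 \<Longrightarrow> n \<ge> p \<Longrightarrow> 0 \<le> e \<Longrightarrow> e \<le> 1 \<Longrightarrow>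
    (\<And>j. j \<in> {2..p} \<Longrightarrow> of_nat n * jump_moment (real n * a / 2) j \<le> ennreal e) \<Longrightarrow>
    ET p n \<le> ennreal (?c ^ p + C * (e + 1 / sqrt (real n)))" by blast
  obtain C0 where C0: "C0 > 0" "\<forall>\<^sub>F x in at_top. norm (tail x) \<le> C0 * norm (x powr (- (real p + 3 / 2)))"
    using O by (rule landau_o.bigE)
  then obtain u0 where u0: "\<And>x. x \<ge> u0 \<Longrightarrow> norm (tail x) \<le> C0 * norm (x powr (- (real p + 3 / 2)))"
    by (auto simp: eventually_at_top_linorder)
  define u where "u = max 1 u0"
  have u: "u > 0" unfolding u_def by auto
  \<comment> \<open>The constant of \<open>n_jump_moment_le\<close> for
    \<open>\<sigma> = 3/2\<close>, where \<open>n powr (1 - \<sigma>)\<close> is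
    \<open>1 / sqrt n\<close>; the term of order \<open>1 / n\<close> is absorbed.\<close>
  define D where "D j = 2 * u ^ (2 * j) * (2 / a) ^ j +
      C0 * ((2 * real j / (real j - 3 / 2) + (real j + 3 / 2) / (3 / 2)) * (a / 2) powr (- (3 / 2)))" for j
  have D0: "D j \<ge> 0" if "j \<in> {2..p}" for j
    unfolding D_def using that a_pos C0 u by (intro add_nonneg_nonneg mult_nonneg_nonneg divide_nonneg_nonneg) auto
  define D' where "D' = (\<Sum>j\<in>{2..p}. D j)"
  have D'0: "D' \<ge> 0" unfolding D'_def using D0 by (intro sum_nonneg) auto
  have jump: "of_nat n * jump_moment (real n * a / 2) j \<le> ennreal (D' / sqrt (real n))"
    if j: "j \<in> {2..p}" and n: "n \<ge> 1" "u \<le> real n * a / 2" for j n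
  proof -
    have tl: "tail t \<le> C0 * t powr (- (real j + 3 / 2))" if "t \<ge> u" for t
    proof -
      have "tail t \<le> C0 * t powr (- (real p + 3 / 2))" using u0[of t] that unfolding u_def by auto
      also have "\<dots> \<le> C0 * t powr (- (real j + 3 / 2))"
        using that C0 j unfolding u_def by (intro mult_left_mono powr_mono) auto
      finally show ?thesis .
    qed
    have "of_nat n * jump_moment (real n * a / 2) j \<le> ennreal (2 * u ^ (2 * j) * (2 / a) ^ j / real n +
      C0 * ((2 * real j / (real j - 3 / 2) + (real j + 3 / 2) / (3 / 2)) * (a / 2) powr (- (3 / 2))) * real n powr (1 - 3 / 2))"
      using j n u tl C0 by (intro n_jump_moment_le) auto
    also have "\<dots> \<le> ennreal (D j / sqrt (real n))"
    proof (intro ennreal_leI)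
      have s: "real n powr (1 - 3 / 2) = 1 / sqrt (real n)"
        using n by (simp add: powr_half_sqrt[symmetric] powr_minus_divide[symmetric])
      have "real n \<le> (real n)\<^sup>2" using n by (simp add: power2_eq_square)
      then have "sqrt (real n) \<le> real n" by (simp add: real_le_lsqrt)
      then have "2 * u ^ (2 * j) * (2 / a) ^ j / real n \<le> 2 * u ^ (2 * j) * (2 / a) ^ j / sqrt (real n)"
        using n a_pos u by (intro divide_left_mono) auto
      then show "2 * u ^ (2 * j) * (2 / a) ^ j / real n +
        C0 * ((2 * real j / (real j - 3 / 2) + (real j + 3 / 2) / (3 / 2)) * (a / 2) powr (- (3 / 2))) * real n powr (1 - 3 / 2)
        \<le> D j / sqrt (real n)"
        unfolding D_def s by (simp add: add_divide_distrib)
    qed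
    also have "\<dots> \<le> ennreal (D' / sqrt (real n))"
      unfolding D'_def using D0 j by (intro ennreal_leI divide_right_mono member_le_sum) auto
    finally show ?thesis .
  qed
  \<comment> \<open>The third moment is finite because \<open>p \<ge> 2\<close> makes the tail
    exponent at least \<open>7/2\<close>.\<close>
  have "integrable M (\<lambda>\<omega>. X 0 \<omega> powr 3)"
    by (rule integrable_powr_of_tail[where u=u and \<epsilon>=C0 and \<alpha>="real p + 3 / 2"]) (use p C0 u u0 in \<open>auto simp: u_def\<close>)
  then have i3: "integrable M (\<lambda>\<omega>. X 0 \<omega> ^ 3)"
    using pos by (subst (asm) Bochner_Integration.integrable_cong[OF refl, of _ _ "\<lambda>\<omega>. X 0 \<omega> ^ 3"])
      (auto intro!: powr_numeral less_imp_le)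
  define m3 where "m3 = expectation (\<lambda>\<omega>. X 0 \<omega> ^ 3)"
  have m3: "m3 \<ge> 0" unfolding m3_def using pos by (intro integral_nonneg_AE AE_I2) (auto simp: less_imp_le)
  have trunc_moment: "b - trunc_moment K \<le> m3 / K" if K: "K > 0" for K
  proof -
    have "b - trunc_moment K = expectation (\<lambda>\<omega>. (X 0 \<omega>)\<^sup>2 - (X 0 \<omega>)\<^sup>2 * indicator {..K} (X 0 \<omega>))"
      unfolding b_def trunc_moment_def using sq integrable_trunc_moment by simp
    also have "\<dots> \<le> expectation (\<lambda>\<omega>. X 0 \<omega> ^ 3 / K)"
    proof (intro integral_mono)
      fix \<omega> assume "\<omega> \<in> space M"
      then have x: "X 0 \<omega> > 0" using pos by auto
      have "K * (X 0 \<omega>)\<^sup>2 \<le> X 0 \<omega> ^ 3" if "X 0 \<omega> > K"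
        using that x by (simp add: power2_eq_square power3_eq_cube mult_right_mono)
      then show "(X 0 \<omega>)\<^sup>2 - (X 0 \<omega>)\<^sup>2 * indicator {..K} (X 0 \<omega>) \<le> X 0 \<omega> ^ 3 / K"
        using x K by (auto simp: indicator_def field_simps)
    qed (use sq integrable_trunc_moment i3 in auto)
    also have "\<dots> = m3 / K" unfolding m3_def by simp
    finally show ?thesis .
  qed
  \<comment> \<open>The first part is the truncation error. The second is the denominator error,
    with the factor 2 from \<open>n - p \<ge> n / 2\<close>.\<close>
  define E where "E = m3 / a + 2 * b * real p / a\<^sup>2"
  have E0: "E \<ge> 0" unfolding E_def using m3 a_pos b_pos by auto
  have low: "lower_bound p n \<ge> ?c ^ p - real p * ?c ^ p / ?c * E / sqrt (real n)" if n: "n \<ge> 2 * p" "n \<ge> 1" for n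
  proof -
    let ?m = "real (n - p)" let ?s = "sqrt (real n)"
    let ?d = "?m * a + real p * ?s"
    let ?y = "?m * trunc_moment ?s / ?d"
    have s: "?s > 0" using n by auto
    have m: "?m \<ge> real n / 2" using n by (auto simp: of_nat_diff)
    have m0: "?m > 0" using m n by linarith
    have d: "?d > 0" using m0 a_pos by (intro add_pos_nonneg) auto
    have y0: "?y \<ge> 0" using m0 d trunc_moment_nonneg by auto
    have bb: "b - trunc_moment ?s \<le> m3 / ?s" using trunc_moment s by auto
    have "?c - ?y = ?m * a * (b - trunc_moment ?s) / (a * ?d) + b * real p * ?s / (a * ?d)"
    proof -
      have "?m * a * (b - trunc_moment ?s) + b * real p * ?s = b * ?d - a * (?m * trunc_moment ?s)"
        by (simp add: algebra_simps)
      then have "?m * a * (b - trunc_moment ?s) / (a * ?d) + b * real p * ?s / (a * ?d) =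
          (b * ?d - a * (?m * trunc_moment ?s)) / (a * ?d)"
        by (simp only: add_divide_distrib[symmetric])
      also have "\<dots> = ?c - ?y"
        using a_pos d by (simp add: diff_divide_distrib)
      finally show ?thesis ..
    qed
    also have "\<dots> \<le> ?m * a * (m3 / ?s) / (a * (?m * a)) + b * real p * ?s / (a * (real n / 2 * a))"
    proof (rule add_mono)
      have "?m * a * (b - trunc_moment ?s) / (a * ?d) \<le> ?m * a * (m3 / ?s) / (a * ?d)"
        using bb m0 a_pos d by (intro divide_right_mono mult_left_mono) auto
      also have "\<dots> \<le> ?m * a * (m3 / ?s) / (a * (?m * a))"
        using m0 a_pos d m3 s by (intro divide_left_mono mult_left_mono mult_pos_pos) auto
      finally show "?m * a * (b - trunc_moment ?s) / (a * ?d) \<le> ?m * a * (m3 / ?s) / (a * (?m * a))" .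
      have "real n / 2 * a \<le> ?m * a" using m a_pos by (intro mult_right_mono) auto
      also have "\<dots> \<le> ?d" using s by auto
      finally show "b * real p * ?s / (a * ?d) \<le> b * real p * ?s / (a * (real n / 2 * a))"
        using n a_pos d b_pos s by (intro divide_left_mono mult_left_mono mult_pos_pos) auto
    qed
    also have "?m * a * (m3 / ?s) / (a * (?m * a)) = m3 / a / ?s" using m0 a_pos by (simp add: field_simps)
    also have "b * real p * ?s / (a * (real n / 2 * a)) = 2 * b * real p / a\<^sup>2 / ?s"
    proof -
      have "b * real p * z / (a * (z * z / 2 * a)) = 2 * b * real p / a\<^sup>2 / z" if "z > 0" for z
        using that a_pos by (simp add: field_simps power2_eq_square)
      from this[OF s] show ?thesis by simp
    qed
    finally have cy: "?c - ?y \<le> E / ?s" unfolding E_def by (simp add: add_divide_distrib)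
    \<comment> \<open>Bernoulli at \<open>y / c\<close> bounds \<open>y ^ p\<close> below by the
      tangent at \<open>c\<close>, which transfers the bound on \<open>c - y\<close> to the
      powers.\<close>
    have "1 + real p * (?y / ?c - 1) \<le> (1 + (?y / ?c - 1)) ^ p"
      using divide_nonneg_pos[OF y0 c] by (intro Bernoulli_inequality) linarith
    then have "?c ^ p * (1 + real p * (?y / ?c - 1)) \<le> ?c ^ p * (?y / ?c) ^ p"
      using c by (intro mult_left_mono) auto
    also have "\<dots> = ?y ^ p" unfolding power_mult_distrib[symmetric] using a_pos b_pos by simp
    finally have "?y ^ p \<ge> ?c ^ p * (1 + real p * (?y / ?c - 1))" .
    also have "?c ^ p * (1 + real p * (?y / ?c - 1)) = ?c ^ p - real p * ?c ^ p / ?c * (?c - ?y)"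
    proof -
      have "z * (1 + r * (y / x - 1)) = z - r * z / x * (x - y)" if "x > 0" for x y z r :: real
        using that by (simp add: field_simps)
      from this[OF c] show ?thesis .
    qed
    finally have 1: "?y ^ p \<ge> ?c ^ p - real p * ?c ^ p / ?c * (?c - ?y)" .
    have "real p * ?c ^ p / ?c * (?c - ?y) \<le> real p * ?c ^ p / ?c * (E / ?s)"
      using a_pos b_pos by (intro mult_left_mono cy) auto
    with 1 show ?thesis unfolding lower_bound_def by simp
  qed
  define CC where "CC = C * (D' + 1) + real p * ?c ^ p / ?c * E"
  \<comment> \<open>The first bound gives \<open>u \<le> \<theta>\<close>; the second gives
    \<open>D' / sqrt n \<le> 1\<close>, the condition \<open>e \<le> 1\<close> in
    \<open>ET_le\<close>.\<close>
  obtain N0 where N0: "real N0 \<ge> max (2 * u / a) (D'\<^sup>2)" using real_arch_simple by blast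
  show ?thesis
  proof (rule that)
    show "CC \<ge> 0" unfolding CC_def using C D'0 E0 a_pos b_pos by auto
    fix n assume n: "n \<ge> max N0 (2 * p + 1)"
    let ?s = "sqrt (real n)"
    have s: "?s > 0" using n by auto
    have "real n \<ge> real N0" using n by auto
    then have n': "real n \<ge> 2 * u / a" "real n \<ge> D'\<^sup>2" using N0 by auto
    have up: "ET p n \<le> ennreal (?c ^ p + C * (D' / ?s + 1 / ?s))"
    proof (rule C(2))
      have "D' \<le> ?s" using n' by (simp add: real_le_rsqrt)
      then show "D' / ?s \<le> 1" using s by simp
      show "of_nat n * jump_moment (real n * a / 2) j \<le> ennreal (D' / ?s)" if "j \<in> {2..p}" for j
        using n n' a_pos that by (intro jump) (auto simp: field_simps)
    qed (use n D'0 in auto)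
    \<comment> \<open>\<open>enn2real\<close> sends infinity to 0, so its monotonicity requires
      finiteness of the larger side.\<close>
    have fin: "ET p n < \<infinity>" by (rule ET_finite[OF ip]) (use n in auto)
    have "enn2real (ET p n) \<le> enn2real (ennreal (?c ^ p + C * (D' / ?s + 1 / ?s)))"
      using up by (intro enn2real_mono) auto
    also have "\<dots> = ?c ^ p + C * (D' / ?s + 1 / ?s)"
      using c C D'0 by (intro enn2real_ennreal add_nonneg_nonneg mult_nonneg_nonneg) auto
    finally have 1: "enn2real (ET p n) - ?c ^ p \<le> C * (D' + 1) / ?s" by (simp add: add_divide_distrib distrib_left)
    have "lower_bound p n = enn2real (ennreal (lower_bound p n))" using lower_bound_nonneg by simp
    also have "\<dots> \<le> enn2real (ET p n)"
      using lower_bound_le_ET[OF p, of n] fin n by (intro enn2real_mono) auto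
    finally have 2: "enn2real (ET p n) - ?c ^ p \<ge> - (real p * ?c ^ p / ?c * E / ?s)" using low[of n] n by auto
    have "0 \<le> C * (D' + 1) / ?s" "0 \<le> real p * ?c ^ p / ?c * E / ?s" using C D'0 E0 a_pos b_pos by auto
    moreover have "CC / ?s = C * (D' + 1) / ?s + real p * ?c ^ p / ?c * E / ?s"
      unfolding CC_def by (simp add: add_divide_distrib)
    ultimately show "\<bar>enn2real (ET p n) - ?c ^ p\<bar> \<le> CC / ?s" using 1 2 by linarith
  qed
qed

section \<open>Tail condition and finite moments\<close>

text \<open>Markov's inequality restricted to \<open>X \<ge> x\<close> bounds
  \<open>x ^ (p + 1) * tail x\<close> by the part of the moment above \<open>x\<close>, which tends
  to 0 by dominated convergence.\<close>

lemma tail_of_moment: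
  assumes "integrable M (\<lambda>\<omega>. X 0 \<omega> ^ (p + 1))"
  shows "tail \<in> o[at_top](\<lambda>x. x powr (- (real p + 1)))"
proof (rule landau_o.smallI)
  fix \<epsilon> :: real assume \<epsilon>: "\<epsilon> > 0"
  let ?g = "\<lambda>x \<omega>. X 0 \<omega> ^ (p + 1) * indicator {x..} (X 0 \<omega>)"
  have "((\<lambda>x. expectation (?g x)) \<longlongrightarrow> expectation (\<lambda>\<omega>. 0)) at_top"
  proof (rule integral_dominated_convergence_at_top[where w="\<lambda>\<omega>. \<bar>X 0 \<omega> ^ (p + 1)\<bar>"])
    show "AE \<omega> in M. ((\<lambda>x. ?g x \<omega>) \<longlongrightarrow> 0) at_top"
    proof (rule AE_I2, rule tendsto_eventually)
      fix \<omega>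
      show "\<forall>\<^sub>F x in at_top. ?g x \<omega> = 0"
        using eventually_gt_at_top[of "X 0 \<omega>"] by eventually_elim simp
    qed
    show "\<forall>\<^sub>F x in at_top. AE \<omega> in M. norm (?g x \<omega>) \<le> \<bar>X 0 \<omega> ^ (p + 1)\<bar>"
      by (intro always_eventually allI AE_I2) (auto simp: indicator_def)
  qed (use assms in auto)
  then have "\<forall>\<^sub>F x in at_top. expectation (?g x) < \<epsilon>"
    using \<epsilon> by (intro order_tendstoD(2)) auto
  then show "\<forall>\<^sub>F x in at_top. norm (tail x) \<le> \<epsilon> * norm (x powr (- (real p + 1)))"
    using eventually_gt_at_top[of 0]
  proof eventually_elim
    case (elim x)
    have "x ^ (p + 1) * tail x = expectation (\<lambda>\<omega>. x ^ (p + 1) * indicator {\<omega>\<in>space M. X 0 \<omega> \<ge> x} \<omega>)"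
      by simp
    also have "\<dots> \<le> expectation (?g x)"
    proof (intro integral_mono)
      show "integrable M (\<lambda>\<omega>. x ^ (p + 1) * indicator {\<omega>\<in>space M. X 0 \<omega> \<ge> x} \<omega>)"
        by (intro integrable_mult_right integrable_real_indicator) (auto simp: emeasure_eq_measure)
      show "integrable M (?g x)"
        by (rule Bochner_Integration.integrable_bound[OF assms]) (auto simp: indicator_def)
      fix \<omega> assume "\<omega> \<in> space M"
      then show "x ^ (p + 1) * indicator {\<omega>\<in>space M. X 0 \<omega> \<ge> x} \<omega> \<le> ?g x \<omega>"
        using elim power_mono[of x "X 0 \<omega>" "p + 1"] by (auto simp: indicator_def)
    qed
    finally have "x ^ (p + 1) * tail x \<le> \<epsilon>" using elim by linarith
    moreover have "x ^ (p + 1) = x powr (real p + 1)"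
      using elim powr_realpow[of x "p + 1"] by (simp add: add.commute)
    ultimately have "x powr (real p + 1) * tail x \<le> \<epsilon>" by (simp only:)
    then have "tail x \<le> \<epsilon> / x powr (real p + 1)" using elim by (simp add: pos_le_divide_eq mult.commute)
    then show ?case unfolding powr_minus_divide using elim by simp
  qed
qed

lemma moments_of_tail:
  assumes o: "tail \<in> o[at_top](\<lambda>x. x powr (- (real p + 1)))" and q: "0 < q" "q < real p + 1"
  shows "integrable M (\<lambda>\<omega>. X 0 \<omega> powr q)"
proof -
  obtain u0 where u0: "\<And>x. x \<ge> u0 \<Longrightarrow> norm (tail x) \<le> 1 * norm (x powr (- (real p + 1)))"
    using landau_o.smallD[OF o, of 1] by (auto simp: eventually_at_top_linorder)
  show ?thesis
    by (rule integrable_powr_of_tail[where u="max 1 u0" and \<epsilon>=1 and \<alpha>="real p + 1"]) (use q u0 in auto)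
qed

end

theorem theorem2:
  fixes M :: "'a measure" and X :: "nat \<Rightarrow> 'a \<Rightarrow> real" and p :: nat
  assumes "prob_space M"
    and meas: "\<And>i. X i \<in> borel_measurable M"
    and indep: "prob_space.indep_vars M (\<lambda>_. borel) X UNIV"
    and ident: "\<And>i. distr M borel (X i) = distr M borel (X 0)"
    and pos: "\<And>i \<omega>. \<omega> \<in> space M \<Longrightarrow> X i \<omega> > 0"
    and sq: "integrable M (\<lambda>\<omega>. (X 0 \<omega>)^2)"
    and p2: "p \<ge> 2"
  defines "c \<equiv> (\<integral>\<omega>. (X 0 \<omega>)^2 \<partial>M) / (\<integral>\<omega>. X 0 \<omega> \<partial>M)"
  shows
    "(((\<lambda>n. \<integral>\<^sup>+\<omega>. ennreal (T_stat X n \<omega> ^ p) \<partial>M) \<longlonglongrightarrow> ennreal (c ^ p))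
       \<longleftrightarrow> (\<lambda>x::real. measure M {\<omega> \<in> space M. X 0 \<omega> \<ge> x}) \<in> o[at_top](\<lambda>x. x powr (-(real p + 1))))
   \<and> ((\<lambda>x::real. measure M {\<omega> \<in> space M. X 0 \<omega> \<ge> x}) \<in> O[at_top](\<lambda>x. x powr (-(real p + 3/2)))
       \<longrightarrow> (\<forall>n\<ge>1. (\<integral>\<^sup>+\<omega>. ennreal (T_stat X n \<omega> ^ p) \<partial>M) < \<infinity>) \<and>
           (\<lambda>n. (\<integral>\<omega>. T_stat X n \<omega> ^ p \<partial>M) - c ^ p) \<in> O(\<lambda>n. 1 / sqrt (real n)))
   \<and> (integrable M (\<lambda>\<omega>. (X 0 \<omega>) ^ (p + 1))
       \<longrightarrow> (\<lambda>n. \<integral>\<^sup>+\<omega>. ennreal (T_stat X n \<omega> ^ p) \<partial>M) \<longlonglongrightarrow> ennreal (c ^ p))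
   \<and> ((\<lambda>n. \<integral>\<^sup>+\<omega>. ennreal (T_stat X n \<omega> ^ p) \<partial>M) \<longlonglongrightarrow> ennreal (c ^ p)
       \<longrightarrow> (\<forall>q::real. 1 \<le> q \<and> q < real p + 1 \<longrightarrow> integrable M (\<lambda>\<omega>. (X 0 \<omega>) powr q)))"
proof -
  interpret prob_space M by fact
  interpret iid_positive M X
    by unfold_locales (fact meas indep ident pos sq)+
  have c: "c = b / a" unfolding c_def a_def b_def ..
  have ET: "(\<lambda>n. \<integral>\<^sup>+\<omega>. ennreal (T_stat X n \<omega> ^ p) \<partial>M) = ET p"
    by (simp add: fun_eq_iff ET_def)
  have iff: "ET p \<longlonglongrightarrow> ennreal (c ^ p) \<longleftrightarrow> tail \<in> o[at_top](\<lambda>x. x powr (- (real p + 1)))"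
    unfolding c using ET_tendsto_of_tail[OF p2] tail_of_ET_tendsto[OF p2] by blast
  have rate: "(\<forall>n\<ge>1. ET p n < \<infinity>) \<and> (\<lambda>n. (\<integral>\<omega>. T_stat X n \<omega> ^ p \<partial>M) - c ^ p) \<in> O(\<lambda>n. 1 / sqrt (real n))"
    if O: "tail \<in> O[at_top](\<lambda>x. x powr (- (real p + 3 / 2)))"
  proof (intro conjI allI impI)
    show "ET p n < \<infinity>" if "n \<ge> 1" for n
      by (intro ET_finite integrable_power_of_tail[OF O]) (use p2 that in auto)
    \<comment> \<open>The identity also holds for an infinite expectation, where both sides are 0;
      the finiteness shown just before excludes this for \<open>n \<ge> 1\<close>.\<close>
    have int: "(\<integral>\<omega>. T_stat X n \<omega> ^ p \<partial>M) = enn2real (ET p n)" for n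
      unfolding ET_def T_stat_eq using Q_nonneg S_nonneg by (intro integral_eq_nn_integral) auto
    from ET_rate[OF p2 O] obtain C N where
      "C \<ge> 0" "\<And>n. n \<ge> N \<Longrightarrow> \<bar>enn2real (ET p n) - (b / a) ^ p\<bar> \<le> C / sqrt (real n)" by blast
    then show "(\<lambda>n. (\<integral>\<omega>. T_stat X n \<omega> ^ p \<partial>M) - c ^ p) \<in> O(\<lambda>n. 1 / sqrt (real n))"
      unfolding int c by (intro bigoI[where c=C] eventually_sequentiallyI[where c=N]) auto
  qed
  \<comment> \<open>The last two claims pass through the tail condition: a finite moment of order
    \<open>p + 1\<close> implies it, and it implies all moments of lower order.\<close>
  show ?thesis
    unfolding ET
    using iff rate tail_of_moment[of p] moments_of_tail[of p] by (auto simp: ET_def[symmetric])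
qed

end
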